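(* Let $T:[0,1)^2\to[0,1)^2$, $T(x,y)=(y,\{-x+\sqrt2y\})$ (the map associated with $\lambda=\sqrt2$). Then $\pi(z)$ is finite for all $z\in(\mathbb Z[\sqrt2]\cap[0,1))^2$, but $\left(T^k\left(\frac{3-\sqrt2}4,\frac{2\sqrt2-1}4\right)\right)_{k\in\mathbb Z}$ is aperiodic.
   Context: $\{u\}=u-\lfloor u\rfloor$ is the fractional part. $T$ is a bijection of $[0,1)^2$. $\pi(z)$ is the least $p\ge1$ with $T^p(z)=z$, and $\pi(z)=\infty$ (the sequence $(T^k(z))_{k\in\mathbb Z}$ is aperiodic) if no such $p$ exists. *)

theory Defs
  imports "HOL-Analysis.Analysis" "HOL-Library.Extended_Nat"
begin

definition unit_square :: "(real \<times> real) set" where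
  "unit_square = {0..<1} \<times> {0..<1}"

text \<open>The map is written as a total function on the plane, but it is only of interest on
  \<open>unit_square\<close>, of which it is a bijection.\<close>

definition rot_map :: "real \<Rightarrow> real \<times> real \<Rightarrow> real \<times> real" where
  "rot_map l = (\<lambda>(x, y). (y, frac (- x + l * y)))"

lemma bij_betw_rot_map: "bij_betw (rot_map l) unit_square unit_square"
proof (rule bij_betw_byWitness[where f' = "\<lambda>(x, y). (frac (l * x - y), x)"])
  have key: "frac (a - frac (a - u)) = u" if "0 \<le> u" "u < 1" for a u :: real
  proof -
    have "a - frac (a - u) = u + of_int \<lfloor>a - u\<rfloor>"
      by (simp add: frac_def)
    then show ?thesis
      using that by (simp add: frac_def floor_eq_iff)
  qed
  show "\<forall>z\<in>unit_square. (case rot_map l z of (x, y) \<Rightarrow> (frac (l * x - y), x)) = z"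
    using key by (auto simp: unit_square_def rot_map_def)
  show "\<forall>z\<in>unit_square. rot_map l (case z of (x, y) \<Rightarrow> (frac (l * x - y), x)) = z"
    using key by (auto simp: unit_square_def rot_map_def)
qed (auto simp: unit_square_def rot_map_def frac_lt_1)

text \<open>The iterates of a bijection \<open>T\<close> of a set \<open>S\<close>, for all integer exponents.\<close>

definition int_iter :: "'a set \<Rightarrow> ('a \<Rightarrow> 'a) \<Rightarrow> int \<Rightarrow> 'a \<Rightarrow> 'a" where
  "int_iter S T k z =
     (if k \<ge> 0 then (T ^^ nat k) z else (inv_into S T ^^ nat (- k)) z)"

definition min_period :: "('a \<Rightarrow> 'a) \<Rightarrow> 'a \<Rightarrow> enat" where
  "min_period T z =
     (if \<exists>p\<ge>1. (T ^^ p) z = z then enat (LEAST p. p \<ge> 1 \<and> (T ^^ p) z = z) else \<infinity>)"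

definition aperiodic :: "(int \<Rightarrow> 'a) \<Rightarrow> bool" where
  "aperiodic s \<longleftrightarrow> \<not> (\<exists>p\<ge>1. \<forall>k. s (k + p) = s k)"

lemma int_iter_Suc:
  assumes bij: "bij_betw T S S" and z: "z \<in> S"
  shows "int_iter S T k z \<in> S" "int_iter S T (k + 1) z = T (int_iter S T k z)"
proof -
  have inv: "bij_betw (inv_into S T) S S"
    by (rule bij_betw_inv_into[OF bij])
  have mem: "(f ^^ n) z \<in> S" if "bij_betw f S S" for f and n :: nat
    using that z by (induction n) (auto dest: bij_betwE)
  show "int_iter S T k z \<in> S"
    using mem[OF bij] mem[OF inv] by (simp add: int_iter_def)
  show "int_iter S T (k + 1) z = T (int_iter S T k z)"
  proof (cases "k \<ge> 0")
    case True
    then have "nat (k + 1) = Suc (nat k)" by simp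
    with True show ?thesis by (simp add: int_iter_def)
  next
    case False
    then obtain n where n: "nat (- k) = Suc n" "k = - int (Suc n)"
      by (metis int_nat_eq nat_0_iff not_le not0_implies_Suc minus_minus neg_0_less_iff_less
          less_imp_le zero_less_nat_eq less_not_refl)
    have "T (inv_into S T ((inv_into S T ^^ n) z)) = (inv_into S T ^^ n) z"
      by (rule bij_betw_inv_into_right[OF bij mem[OF inv]])
    with n show ?thesis by (cases n) (auto simp: int_iter_def nat_add_distrib)
  qed
qed

lemma min_period_eq_infinity_iff:
  assumes bij: "bij_betw T S S" and z: "z \<in> S"
  shows "min_period T z = \<infinity> \<longleftrightarrow> aperiodic (\<lambda>k. int_iter S T k z)"
proof -
  let ?s = "\<lambda>k. int_iter S T k z"
  have "(\<exists>p\<ge>1. (T ^^ p) z = z) \<longleftrightarrow> (\<exists>p\<ge>1. \<forall>k. ?s (k + p) = ?s k)"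
  proof
    assume "\<exists>p\<ge>1. (T ^^ p) z = z"
    then obtain p where p: "p \<ge> 1" "(T ^^ p) z = z" by blast
    have "?s (k + int p) = ?s k" for k
    proof (induction k rule: int_induct[where k = 0])
      case base
      show ?case using p by (simp add: int_iter_def)
    next
      case (step1 i)
      then show ?case
        using int_iter_Suc(2)[OF bij z, of i] int_iter_Suc(2)[OF bij z, of "i + int p"]
        by (simp add: algebra_simps)
    next
      case (step2 i)
      have "T (?s (i - 1 + int p)) = T (?s (i - 1))"
        using step2 int_iter_Suc(2)[OF bij z, of "i - 1"]
          int_iter_Suc(2)[OF bij z, of "i - 1 + int p"]
        by (simp add: algebra_simps)
      then show ?case
        using int_iter_Suc(1)[OF bij z] bij by (meson bij_betw_def inj_onD)
    qed
    with p show "\<exists>p\<ge>1. \<forall>k. ?s (k + p) = ?s k"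
      by (intro exI[of _ "int p"]) auto
  next
    assume "\<exists>p\<ge>1. \<forall>k. ?s (k + p) = ?s k"
    then obtain p where p: "p \<ge> 1" "?s (0 + p) = ?s 0" by blast
    then show "\<exists>p\<ge>1. (T ^^ p) z = z"
      by (intro exI[of _ "nat p"]) (auto simp: int_iter_def)
  qed
  then show ?thesis by (simp add: min_period_def aperiodic_def)
qed

definition Z_sqrt2 :: "real set" where
  "Z_sqrt2 = {of_int a + of_int b * sqrt 2 |a b. True}"

end

theory Submission
  imports Defs
begin

text \<open>
  The map acts, up to an affine change of coordinates, as a piecewise rotation by \<open>\<pi>/4\<close>, and it is
  renormalizable. The points where \<open>\<lfloor>\<surd>2 y - x\<rfloor> = 1\<close> form a triangle, which is right and isosceles in
  the metric that the linear part of \<open>T\<close> preserves. In coordinates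
  \<open>(a, b)\<close> adapted to its sides (\<open>chart\<close>), the map \<open>ret\<close> of the open triangle, which is a power of
  \<open>T\<close> on each of three pieces (\<open>rot_speeds_up_ret\<close>), has an exactly self-similar copy of itself:
  \<open>shrink\<close>, a reflection composed with a contraction by \<open>\<surd>2 - 1\<close>, satisfies
  \<open>shrink \<circ> ret = ret\<^sup>k \<circ> shrink\<close> with \<open>k\<close> equal to 2, 4 or 5 on the three pieces
  (\<open>ret_renormalizes\<close>). A point of the square whose \<open>T\<close>-orbit avoids the closed triangle is periodic, as
  is every boundary point that never enters the open triangle (\<open>avoiding_eventually_periodic\<close>,
  \<open>closed_triangle\<close>), so only \<open>ret\<close> matters.

  Lattice points. Follow a point of the triangle by \<open>ret\<close> until it lands in the image of \<open>shrink\<close>, and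
  magnify by the inverse of \<open>shrink\<close>. If that never happens the point is periodic. Otherwise the
  magnification scales the plane by \<open>1 + \<surd>2\<close>, hence the plane of conjugates by the small number
  \<open>1 - \<surd>2\<close>. So the conjugates are pulled towards a fixed bounded region, measured by a quadratic form
  that the conjugate rotation preserves (\<open>descent\<close>). Since \<open>\<int>[\<surd>2]\<close> is discrete when embedded
  together with its conjugates, repetition leads to finitely many points. There are in fact
  two (\<open>eventually_periodic_small\<close>), both periodic, and
  periodicity is inherited back along the descent (\<open>eventually_periodic_speedup\<close>).

  The exceptional point. Two steps of \<open>T\<close> lead to the point \<open>z\<close> of the triangle with coordinates
  \<open>((1 + \<surd>2)/4, 1/4)\<close>, and the \<open>ret\<close>-orbit of \<open>z\<close> contains \<open>shrink\<^sup>4 z\<close>. By renormalization it then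
  contains \<open>shrink\<^sup>4\<^sup>n z\<close> for all \<open>n\<close>. These points are distinct, because \<open>shrink\<close> multiplies the
  positive coordinate \<open>b\<close> by \<open>\<surd>2 - 1\<close>, so the orbit is infinite.
\<close>

section \<open>Orbits with a repetition\<close>

definition eventually_periodic :: "('a \<Rightarrow> 'a) \<Rightarrow> 'a \<Rightarrow> bool" where
  "eventually_periodic f z \<longleftrightarrow> (\<exists>i j. i < j \<and> (f ^^ i) z = (f ^^ j) z)"

lemma eventually_periodic_return:
  assumes "(f ^^ n) z = z" "n > 0"
  shows "eventually_periodic f z"
  unfolding eventually_periodic_def using assms by (intro exI[of _ 0] exI[of _ n]) auto

lemma eventually_periodic_funpow:
  assumes "eventually_periodic f ((f ^^ k) z)"
  shows "eventually_periodic f z"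
proof -
  obtain i j where "i < j" "(f ^^ i) ((f ^^ k) z) = (f ^^ j) ((f ^^ k) z)"
    using assms by (auto simp: eventually_periodic_def)
  then have "i + k < j + k" "(f ^^ (i + k)) z = (f ^^ (j + k)) z"
    by (simp_all add: funpow_add)
  then show ?thesis
    unfolding eventually_periodic_def by blast
qed

lemma funpow_in:
  assumes "\<And>z. z \<in> S \<Longrightarrow> f z \<in> S" "z \<in> S"
  shows "(f ^^ n) z \<in> S"
  using assms by (induction n) auto

lemma funpow_funpow_diff:
  assumes "i \<le> j"
  shows "(f ^^ (j - i)) ((f ^^ i) z) = (f ^^ j) z"
  using assms by (metis comp_apply funpow_add le_add_diff_inverse2)

text \<open>
  Both renormalization and the passage from \<open>T\<close> to a return map have the form treated here: one
  step of \<open>f\<close> becomes, after the embedding \<open>h\<close>, a positive and point-dependent number of steps of \<open>g\<close>.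
\<close>

lemma speedup_reaches:
  assumes inv: "\<And>z. z \<in> S \<Longrightarrow> f z \<in> S"
    and step: "\<And>z. z \<in> S \<Longrightarrow> \<exists>k>0. (g ^^ k) (h z) = h (f z)"
    and z: "z \<in> S"
  shows "\<exists>k\<ge>n. (g ^^ k) (h z) = h ((f ^^ n) z)"
proof (induction n)
  case 0
  show ?case by (intro exI[of _ 0]) simp
next
  case (Suc n)
  then obtain k where k: "k \<ge> n" "(g ^^ k) (h z) = h ((f ^^ n) z)" by blast
  have "(f ^^ n) z \<in> S" using funpow_in[of S f z n] inv z by blast
  from step[OF this] obtain l where l: "l > 0" "(g ^^ l) (h ((f ^^ n) z)) = h (f ((f ^^ n) z))"
    by blast
  have "(g ^^ (l + k)) (h z) = h ((f ^^ Suc n) z)"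
    using k l by (simp add: funpow_add)
  moreover have "l + k \<ge> Suc n" using k l by simp
  ultimately show ?case by blast
qed

lemma eventually_periodic_speedup:
  assumes inv: "\<And>z. z \<in> S \<Longrightarrow> f z \<in> S"
    and step: "\<And>z. z \<in> S \<Longrightarrow> \<exists>k>0. (g ^^ k) (h z) = h (f z)"
    and z: "z \<in> S" and per: "eventually_periodic f z"
  shows "eventually_periodic g (h z)"
proof -
  obtain i j where ij: "i < j" "(f ^^ i) z = (f ^^ j) z"
    using per by (auto simp: eventually_periodic_def)
  obtain k where k: "(g ^^ k) (h z) = h ((f ^^ i) z)"
    using speedup_reaches[of S f g h z i] inv step z by blast
  have "(f ^^ i) z \<in> S" using funpow_in[of S f z i] inv z by blast
  then obtain l where l: "l \<ge> j - i" "(g ^^ l) (h ((f ^^ i) z)) = h ((f ^^ (j - i)) ((f ^^ i) z))"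
    using speedup_reaches[of S f g h "(f ^^ i) z" "j - i"] inv step by blast
  have "(f ^^ (j - i)) ((f ^^ i) z) = (f ^^ j) z"
    using ij(1) by (simp add: funpow_funpow_diff)
  then have "(g ^^ (l + k)) (h z) = (g ^^ k) (h z)"
    using k l ij by (simp add: funpow_add)
  moreover have "k < l + k" using l ij by simp
  ultimately show ?thesis
    unfolding eventually_periodic_def by metis
qed

lemma periodic_if_eventually_periodic:
  assumes bij: "bij_betw f S S" and z: "z \<in> S" and per: "eventually_periodic f z"
  shows "\<exists>p\<ge>1. (f ^^ p) z = z"
proof -
  obtain i j where ij: "i < j" "(f ^^ i) z = (f ^^ j) z"
    using per by (auto simp: eventually_periodic_def)
  have f: "f x \<in> S" if "x \<in> S" for x
    using bij that by (rule bij_betw_apply)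
  have "(f ^^ i) x = (f ^^ i) y \<Longrightarrow> x \<in> S \<Longrightarrow> y \<in> S \<Longrightarrow> x = y" for x y
  proof (induction i)
    case (Suc i)
    then show ?case
      using bij funpow_in[of S f, OF f] by (auto simp: bij_betw_def dest: inj_onD)
  qed simp
  moreover have "(f ^^ i) ((f ^^ (j - i)) z) = (f ^^ i) z"
    using ij by (metis comp_apply funpow_add le_add_diff_inverse less_imp_le)
  ultimately have "(f ^^ (j - i)) z = z"
    using z funpow_in[of S f z, OF f] by blast
  with ij show ?thesis by (intro exI[of _ "j - i"]) auto
qed

section \<open>A renormalizable map of a triangle\<close>

abbreviation T :: "real \<times> real \<Rightarrow> real \<times> real" where
  "T \<equiv> rot_map (sqrt 2)"

text \<open>
  The affine map that takes \<open>triangle\<close> below to the set of points with \<open>x > 0\<close>, \<open>y < 1\<close> and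
  \<open>\<surd>2 y - x > 1\<close>. As \<open>\<surd>2 - 1\<close> is a unit of \<open>\<int>[\<surd>2]\<close>, it matches lattice points with lattice points.
\<close>

definition chart :: "real \<times> real \<Rightarrow> real \<times> real" where
  "chart = (\<lambda>(a, b). ((sqrt 2 - 1) * a, 1 - (sqrt 2 - 1) * b))"

definition triangle :: "(real \<times> real) set" where
  "triangle = {(a, b). 0 < a \<and> 0 < b \<and> a + sqrt 2 * b < 1}"

text \<open>
  A return map of \<open>T\<close> to the triangle, read in the chart. The three cases are \<open>T\<^sup>5\<close>, \<open>T\<^sup>1\<^sup>4\<close> and
  \<open>T\<^sup>1\<^sup>6\<close>. The line in the last case separates the other two pieces; its points pass through
  two sides of the triangle before they return to the interior.
\<close>

definition ret :: "real \<times> real \<Rightarrow> real \<times> real" where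
  "ret = (\<lambda>(a, b).
     if sqrt 2 * a + b > sqrt 2 - 1 then (b, 1 - a - sqrt 2 * b)
     else if sqrt 2 * a + b < sqrt 2 - 1
       then (a + sqrt 2 * b + (sqrt 2 - 1), sqrt 2 - 1 - sqrt 2 * a - b)
     else (a + (sqrt 2 - 1), b))"

text \<open>
  Its image is the part of the triangle where \<open>a + \<surd>2 b < \<surd>2 - 1\<close>. As a map of the plane of \<open>T\<close>
  it is a similarity that reverses orientation: it takes each leg of the triangle to the other
  leg of the small copy.
\<close>

definition shrink :: "real \<times> real \<Rightarrow> real \<times> real" where
  "shrink = (\<lambda>(a, b). ((sqrt 2 - 1) * (1 - a - sqrt 2 * b), (sqrt 2 - 1) * b))"

lemma sqrt2_sq: "sqrt 2 * sqrt 2 = (2::real)" "sqrt 2 * (sqrt 2 * x) = (2 * x :: real)"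
  by (simp_all flip: mult.assoc)

text \<open>The descent bound at the end of the lattice argument needs \<open>12 \<surd>2 \<le> 17\<close>, hence these digits.\<close>

lemma sqrt2_bounds: "sqrt 2 > (1414 / 1000 :: real)" "sqrt 2 < (1415 / 1000 :: real)"
  by (rule real_less_rsqrt, simp add: power2_eq_square) (rule real_less_lsqrt, simp_all add: power2_eq_square)

lemmas expand = sqrt2_sq algebra_simps

lemma ret_high: "sqrt 2 * a + b > sqrt 2 - 1 \<Longrightarrow> ret (a, b) = (b, 1 - a - sqrt 2 * b)"
  and ret_low: "sqrt 2 * a + b < sqrt 2 - 1 \<Longrightarrow>
    ret (a, b) = (a + sqrt 2 * b + (sqrt 2 - 1), sqrt 2 - 1 - sqrt 2 * a - b)"
  and ret_mid: "sqrt 2 * a + b = sqrt 2 - 1 \<Longrightarrow> ret (a, b) = (a + (sqrt 2 - 1), b)"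
  by (simp_all add: ret_def)

lemma less_sqrt2_mult: "a > 0 \<Longrightarrow> sqrt 2 * a - a > (0::real)"
  using sqrt2_bounds by simp

lemma ret_in_triangle: "z \<in> triangle \<Longrightarrow> ret z \<in> triangle"
proof -
  assume "z \<in> triangle"
  then obtain a b where z: "z = (a, b)" "0 < a" "0 < b" "a + sqrt 2 * b < 1"
    by (auto simp: triangle_def)
  consider "sqrt 2 * a + b > sqrt 2 - 1" | "sqrt 2 * a + b < sqrt 2 - 1" | "sqrt 2 * a + b = sqrt 2 - 1"
    by linarith
  then show ?thesis
  proof cases
    case 1
    with z show ?thesis by (simp add: ret_high triangle_def expand)
  next
    case 2
    have "b * sqrt 2 > 0" using z by simp
    then have "a + sqrt 2 * b + (sqrt 2 - 1) > 0"
      using z sqrt2_bounds by (simp only: expand)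
    with 2 z show ?thesis
      by (simp add: ret_low triangle_def) (simp add: expand)
  next
    case 3
    then have "b = sqrt 2 - 1 - sqrt 2 * a" by simp
    with z sqrt2_bounds show ?thesis by (simp add: ret_mid triangle_def expand)
  qed
qed

lemma shrink_in_triangle:
  assumes "z \<in> triangle"
  shows "shrink z \<in> triangle"
proof -
  obtain a b where z: "z = (a, b)" "0 < a" "0 < b" "a + sqrt 2 * b < 1"
    using assms by (auto simp: triangle_def)
  have "a < a * sqrt 2" using z sqrt2_bounds by simp
  then have "(sqrt 2 - 1) * (1 - a - sqrt 2 * b) + sqrt 2 * ((sqrt 2 - 1) * b) < 1"
    using sqrt2_bounds by (simp only: expand)
  then show ?thesis
    using z sqrt2_bounds by (simp add: shrink_def triangle_def)
qed

text \<open>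
  Two steps take the low piece into the image of \<open>shrink\<close>. The formula shows more: the result is
  \<open>shrink\<close> applied to \<open>(b, a)\<close> multiplied by \<open>1 + \<surd>2\<close>.
\<close>

lemma ret_ret_low:
  assumes "(a, b) \<in> triangle" "sqrt 2 * a + b < sqrt 2 - 1"
  shows "ret (ret (a, b)) = (sqrt 2 - 1 - sqrt 2 * a - b, a)"
  using assms sqrt2_bounds by (simp add: ret_low ret_high triangle_def expand)

text \<open>
  The copy of \<open>ret\<close> on the image of \<open>shrink\<close> is a power of \<open>ret\<close> on each piece. For a high point the
  shrunken point is low, for a low point it takes three high steps before it is low, and for a
  point of the middle line it first makes a middle and a high step; each time \<open>ret_ret_low\<close> then
  brings it home.
\<close>

lemma ret_renormalizes:
  assumes z: "z \<in> triangle"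
  shows "\<exists>k>0. (ret ^^ k) (shrink z) = shrink (ret z)"
proof -
  obtain a b where z': "z = (a, b)" "0 < a" "0 < b" "a + sqrt 2 * b < 1"
    using z by (auto simp: triangle_def)
  let ?k = "sqrt 2 - 1 :: real" and ?c = "1 - a - sqrt 2 * b"
  have s: "shrink z = (?k * ?c, ?k * b)" by (simp add: shrink_def z')
  have st: "(?k * ?c, ?k * b) \<in> triangle" using shrink_in_triangle[OF z] s by simp
  consider "sqrt 2 * a + b > ?k" | "sqrt 2 * a + b < ?k" | "sqrt 2 * a + b = ?k"
    by linarith
  then show ?thesis
  proof cases
    case 1
    have "sqrt 2 * (?k * ?c) + ?k * b < ?k"
      using less_sqrt2_mult[of "sqrt 2 * a + b - ?k"] 1 by (simp add: expand)
    from ret_ret_low[OF st this] show ?thesis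
      by (intro exI[of _ 2]) (simp add: s, simp add: z' ret_high[OF 1] shrink_def expand numeral_2_eq_2)
  next
    case 2
    let ?e = "?k - sqrt 2 * a - b"
    have r1: "ret (?k * ?c, ?k * b) = (?k * b, 1 - ?k + ?k * a)"
      using less_sqrt2_mult[of ?e] 2 by (subst ret_high) (simp_all add: expand)
    have "b * sqrt 2 < b * 2" "a < a * sqrt 2" using z' sqrt2_bounds by simp_all
    then have "sqrt 2 * (?k * b) + (1 - ?k + ?k * a) > ?k"
      using sqrt2_bounds by (simp only: expand)
    then have r2: "ret (?k * b, 1 - ?k + ?k * a) = (1 - ?k + ?k * a, ?k * ?e)"
      by (simp add: ret_high) (simp add: expand)
    have r3: "ret (1 - ?k + ?k * a, ?k * ?e) = (?k * ?e, 1 - 2 * ?k + ?k * a + sqrt 2 * ?k * b)"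
      using less_sqrt2_mult[of ?e] less_sqrt2_mult[of a] 2 z' sqrt2_bounds
      by (subst ret_high) (simp_all add: expand)
    have t3: "(?k * ?e, 1 - 2 * ?k + ?k * a + sqrt 2 * ?k * b) \<in> triangle"
      using ret_in_triangle[OF ret_in_triangle[OF ret_in_triangle[OF st]]] by (simp only: r1 r2 r3)
    have "sqrt 2 * (?k * ?e) + (1 - 2 * ?k + ?k * a + sqrt 2 * ?k * b) < ?k"
      using less_sqrt2_mult[of a] z' by (simp add: expand)
    note r45 = ret_ret_low[OF t3 this]
    have "(ret ^^ 5) x = ret (ret (ret (ret (ret x))))" for x
      by (simp add: eval_nat_numeral)
    then have "(ret ^^ 5) (shrink z) = shrink (ret z)"
      by (simp only: s r1 r2 r3 r45) (simp add: z' ret_low[OF 2] shrink_def expand)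
    then show ?thesis by (intro exI[of _ 5]) simp
  next
    case 3
    then have b: "b = sqrt 2 - 1 - sqrt 2 * a" by simp
    have r1: "ret (?k * ?c, ?k * b) = (?k * ?c + ?k, ?k * b)"
      by (rule ret_mid) (simp add: b expand)
    have r2: "ret (?k * ?c + ?k, ?k * b) = (?k * b, ?k * ?c)"
      using z' sqrt2_bounds by (subst ret_high) (simp_all add: b expand)
    have t2: "(?k * b, ?k * ?c) \<in> triangle"
      using ret_in_triangle[OF ret_in_triangle[OF st]] by (simp only: r1 r2)
    have rz: "ret z = (a + ?k, b)" by (simp only: z' ret_mid[OF 3])
    have "sqrt 2 * (?k * b) + ?k * ?c < ?k"
      using less_sqrt2_mult[of a] z' by (simp add: expand)
    note r34 = ret_ret_low[OF t2 this]
    have "(ret ^^ 4) x = ret (ret (ret (ret x)))" for x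
      by (simp add: eval_nat_numeral)
    then have "(ret ^^ 4) (shrink z) = shrink (ret z)"
      by (simp only: s r1 r2 r34) (simp add: rz shrink_def, simp add: b expand)
    then show ?thesis by (intro exI[of _ 4]) simp
  qed
qed


section \<open>Conjugation in the ring generated by the square root of two\<close>

text \<open>
  Conjugation as a relation on the reals: a lattice point can carry its conjugate along, and
  the closure rules compute it.
\<close>

definition conjugates :: "real \<Rightarrow> real \<Rightarrow> bool" where
  "conjugates x x' \<longleftrightarrow>
     (\<exists>m n :: int. x = of_int m + of_int n * sqrt 2 \<and> x' = of_int m - of_int n * sqrt 2)"

lemma conjugates_int [simp]: "conjugates (of_int k) (of_int k)"
  unfolding conjugates_def by (rule exI[of _ k], rule exI[of _ 0]) simp

lemma conjugates_1 [simp]: "conjugates 1 1"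
  using conjugates_int[of 1] by simp

lemma conjugates_sqrt2 [simp]: "conjugates (sqrt 2) (- sqrt 2)"
  unfolding conjugates_def by (rule exI[of _ 0], rule exI[of _ 1]) simp

lemma conjugates_add:
  assumes "conjugates x x'" "conjugates y y'"
  shows "conjugates (x + y) (x' + y')"
proof -
  obtain m n k l :: int where mn:
    "x = of_int m + of_int n * sqrt 2" "x' = of_int m - of_int n * sqrt 2"
    "y = of_int k + of_int l * sqrt 2" "y' = of_int k - of_int l * sqrt 2"
    using assms by (auto simp: conjugates_def)
  show ?thesis
    unfolding conjugates_def mn
    by (rule exI[of _ "m + k"], rule exI[of _ "n + l"]) (simp add: algebra_simps)
qed

lemma conjugates_diff:
  assumes "conjugates x x'" "conjugates y y'"
  shows "conjugates (x - y) (x' - y')"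
proof -
  obtain m n k l :: int where mn:
    "x = of_int m + of_int n * sqrt 2" "x' = of_int m - of_int n * sqrt 2"
    "y = of_int k + of_int l * sqrt 2" "y' = of_int k - of_int l * sqrt 2"
    using assms by (auto simp: conjugates_def)
  show ?thesis
    unfolding conjugates_def mn
    by (rule exI[of _ "m - k"], rule exI[of _ "n - l"]) (simp add: algebra_simps)
qed

lemma conjugates_mult:
  assumes "conjugates x x'" "conjugates y y'"
  shows "conjugates (x * y) (x' * y')"
proof -
  obtain m n k l :: int where mn:
    "x = of_int m + of_int n * sqrt 2" "x' = of_int m - of_int n * sqrt 2"
    "y = of_int k + of_int l * sqrt 2" "y' = of_int k - of_int l * sqrt 2"
    using assms by (auto simp: conjugates_def)
  show ?thesis
    unfolding conjugates_def mn
    by (rule exI[of _ "m * k + 2 * (n * l)"], rule exI[of _ "m * l + n * k"]) (simp add: expand)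
qed

lemmas conjugates_intros = conjugates_add conjugates_diff conjugates_mult

lemma square_eq_twice_square:
  fixes m n :: nat
  assumes "m * m = 2 * (n * n)"
  shows "n = 0"
  using assms
proof (induction n arbitrary: m rule: less_induct)
  case (less n)
  have "even (m * m)" using less.prems by simp
  then obtain k where k: "m = 2 * k" by (auto elim: evenE)
  then have nk: "n * n = 2 * (k * k)" using less.prems by simp
  then have "even (n * n)" by simp
  then obtain l where l: "n = 2 * l" by (auto elim: evenE)
  then have "k * k = 2 * (l * l)" using nk by simp
  then show ?case using less.IH[of l k] l by fastforce
qed

lemma conjugates_unique:
  assumes "conjugates x x'" "conjugates x x''"
  shows "x' = x''"
proof -
  obtain m n :: int where
    x: "x = of_int m + of_int n * sqrt 2" "x' = of_int m - of_int n * sqrt 2"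
    using assms(1) unfolding conjugates_def by blast
  obtain k l :: int where
    y: "x = of_int k + of_int l * sqrt 2" "x'' = of_int k - of_int l * sqrt 2"
    using assms(2) unfolding conjugates_def by blast
  from x y have "of_int (m - k) = of_int (l - n) * sqrt 2" by (simp add: algebra_simps)
  then have "(of_int (m - k) :: real) * of_int (m - k)
      = (of_int (l - n) * sqrt 2) * (of_int (l - n) * sqrt 2)"
    by (simp only:)
  also have "\<dots> = 2 * (of_int (l - n) * of_int (l - n))"
    by (simp add: expand)
  finally have "(of_int (m - k) :: real) * of_int (m - k) = 2 * (of_int (l - n) * of_int (l - n))" .
  then have "(m - k) * (m - k) = 2 * ((l - n) * (l - n))"
    by (metis of_int_eq_iff of_int_mult of_int_numeral)
  then have "nat \<bar>m - k\<bar> * nat \<bar>m - k\<bar> = 2 * (nat \<bar>l - n\<bar> * nat \<bar>l - n\<bar>)"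
    by (simp flip: nat_mult_distrib abs_mult)
  then have "l = n" using square_eq_twice_square by fastforce
  with x y show ?thesis by simp
qed

section \<open>Descent on lattice points\<close>

text \<open>
  Under conjugation the linear part \<open>(a, b) \<mapsto> (b, - a - \<surd>2 b)\<close> of the high branch of \<open>ret\<close> becomes
  \<open>(a, b) \<mapsto> (b, - a + \<surd>2 b)\<close>, which preserves the positive definite form \<open>u\<^sup>2 - \<surd>2 u v + v\<^sup>2\<close>. The
  conjugate high branch therefore preserves the form centred at its fixed point, both of whose
  coordinates are \<open>1 + \<surd>2/2\<close>.
\<close>

definition conj_size :: "real \<Rightarrow> real \<Rightarrow> real" where
  "conj_size a b = (a - (1 + sqrt 2 / 2))\<^sup>2
     - sqrt 2 * (a - (1 + sqrt 2 / 2)) * (b - (1 + sqrt 2 / 2)) + (b - (1 + sqrt 2 / 2))\<^sup>2"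

lemma conj_size_invariant: "conj_size b (1 - a + sqrt 2 * b) = conj_size a b"
  by (simp add: conj_size_def power2_eq_square expand)

lemma form_complete_square:
  "u\<^sup>2 - sqrt 2 * u * v + v\<^sup>2 = (u - sqrt 2 / 2 * v)\<^sup>2 + v\<^sup>2 / (2::real)"
  by (simp add: power2_eq_square expand)

lemma form_nonneg: "u\<^sup>2 - sqrt 2 * u * v + v\<^sup>2 \<ge> (0::real)"
  by (simp add: form_complete_square)

text \<open>
  The conjugates of the two magnifications that occur in the descent. Both contract the form by the
  factor \<open>(\<surd>2 - 1)\<^sup>2\<close> and shift the centre; weakening the factor to \<open>\<surd>2 - 1\<close> absorbs the shift into a
  constant. The difference of the two sides is then a multiple of a form centred at
  \<open>3 + 2\<surd>2\<close>, the point where equality holds.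
\<close>

lemma conj_size_swap:
  "conj_size ((1 - sqrt 2) * b) ((1 - sqrt 2) * a) \<le> (sqrt 2 - 1) * conj_size a b + (3 + 2 * sqrt 2)"
proof -
  let ?u = "a - (3 + 2 * sqrt 2)" and ?v = "b - (3 + 2 * sqrt 2)"
  have "(sqrt 2 - 1) * conj_size a b + (3 + 2 * sqrt 2) - conj_size ((1 - sqrt 2) * b) ((1 - sqrt 2) * a)
      = (sqrt 2 - 1) * (2 - sqrt 2) * (?u\<^sup>2 - sqrt 2 * ?u * ?v + ?v\<^sup>2)"
    by (simp add: conj_size_def power2_eq_square expand)
  moreover have "\<dots> \<ge> 0"
    using form_nonneg[of ?u ?v] sqrt2_bounds by (intro mult_nonneg_nonneg) auto
  ultimately show ?thesis by linarith
qed

lemma conj_size_line: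
  "conj_size ((1 - sqrt 2) * a) (1 - (2 - sqrt 2) * a)
     \<le> (sqrt 2 - 1) * conj_size a (sqrt 2 * a - (1 + sqrt 2)) + (3 + 2 * sqrt 2)"
proof -
  let ?u = "a - (3 + 2 * sqrt 2)"
  have "(sqrt 2 - 1) * conj_size a (sqrt 2 * a - (1 + sqrt 2)) + (3 + 2 * sqrt 2)
      - conj_size ((1 - sqrt 2) * a) (1 - (2 - sqrt 2) * a)
      = (sqrt 2 - 1) * (2 - sqrt 2) * ?u\<^sup>2"
    by (simp add: conj_size_def power2_eq_square expand)
  moreover have "\<dots> \<ge> 0"
    using sqrt2_bounds by (intro mult_nonneg_nonneg) auto
  ultimately show ?thesis by linarith
qed

text \<open>The size of a point is only meaningful if both coordinates lie in \<open>\<int>[\<surd>2]\<close>, hence a relation.\<close>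

definition lattice_size :: "real \<times> real \<Rightarrow> real \<Rightarrow> bool" where
  "lattice_size z s \<longleftrightarrow>
     (\<exists>a b. conjugates (fst z) a \<and> conjugates (snd z) b \<and> s = conj_size a b)"

lemma lattice_size_swap:
  assumes "lattice_size (a, b) s"
  shows "\<exists>s'\<le>(sqrt 2 - 1) * s + (3 + 2 * sqrt 2). lattice_size ((1 + sqrt 2) * b, (1 + sqrt 2) * a) s'"
proof -
  obtain a' b' where ab: "conjugates a a'" "conjugates b b'" "s = conj_size a' b'"
    using assms by (auto simp: lattice_size_def)
  have u: "conjugates (1 + sqrt 2) (1 - sqrt 2)"
    using conjugates_add[OF conjugates_1 conjugates_sqrt2] by simp
  show ?thesis
    unfolding lattice_size_def fst_conv snd_conv ab(3)
    using conj_size_swap[of b' a'] conjugates_mult[OF u ab(1)] conjugates_mult[OF u ab(2)] by blast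
qed

text \<open>
  On the middle line the second conjugate is determined by the first, which needs the
  uniqueness of conjugates.
\<close>

lemma lattice_size_line:
  assumes "lattice_size (a, sqrt 2 - 1 - sqrt 2 * a) s"
  shows "\<exists>s'\<le>(sqrt 2 - 1) * s + (3 + 2 * sqrt 2).
    lattice_size ((1 + sqrt 2) * a, 1 - (2 + sqrt 2) * a) s'"
proof -
  obtain a' b' where ab: "conjugates a a'" "conjugates (sqrt 2 - 1 - sqrt 2 * a) b'" "s = conj_size a' b'"
    using assms by (auto simp: lattice_size_def)
  have "conjugates (sqrt 2 - 1 - sqrt 2 * a) (- sqrt 2 - 1 - (- sqrt 2) * a')"
    using ab(1) by (intro conjugates_intros) simp_all
  then have b': "b' = sqrt 2 * a' - (1 + sqrt 2)"
    using conjugates_unique[OF ab(2)] by fastforce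
  have "conjugates ((1 + sqrt 2) * a) ((1 + - sqrt 2) * a')"
    using ab(1) by (intro conjugates_intros) simp_all
  moreover have "conjugates (1 - (1 + 1 + sqrt 2) * a) (1 - (1 + 1 + - sqrt 2) * a')"
    using ab(1) by (intro conjugates_intros) simp_all
  ultimately show ?thesis
    unfolding lattice_size_def fst_conv snd_conv ab(3) b'
    using conj_size_line[of a'] by auto
qed

text \<open>The high branch of \<open>ret\<close>, a rotation of order eight in suitable coordinates.\<close>

abbreviation turn :: "real \<times> real \<Rightarrow> real \<times> real" where
  "turn \<equiv> \<lambda>(a, b). (b, 1 - a - sqrt 2 * b)"

lemma turn_order_8: "(turn ^^ 8) z = z"
proof -
  have half: "(turn ^^ 4) (a, b) = (2 - sqrt 2 - a, 2 - sqrt 2 - b)" for a b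
  proof -
    have "turn (turn (a, b)) = (1 - a - sqrt 2 * b, 1 - sqrt 2 + sqrt 2 * a + b)"
      by (simp add: expand)
    then have "turn (turn (turn (turn (a, b)))) = (2 - sqrt 2 - a, 2 - sqrt 2 - b)"
      by (simp add: expand)
    then show ?thesis by (simp add: eval_nat_numeral)
  qed
  have "(turn ^^ (4 + 4)) z = z"
    by (cases z) (simp only: funpow_add comp_apply half, simp)
  then show ?thesis by simp
qed

lemma lattice_size_turn:
  assumes "lattice_size z s"
  shows "lattice_size (turn z) s"
proof -
  obtain a b where z: "z = (a, b)" by (cases z)
  obtain a' b' where ab: "conjugates a a'" "conjugates b b'" "s = conj_size a' b'"
    using assms z by (auto simp: lattice_size_def)
  have "conjugates (1 - a - sqrt 2 * b) (1 - a' - (- sqrt 2) * b')"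
    using ab by (intro conjugates_intros) simp_all
  then have "conjugates b b' \<and> conjugates (1 - a - sqrt 2 * b) (1 - a' + sqrt 2 * b')
      \<and> s = conj_size b' (1 - a' + sqrt 2 * b')"
    using ab conj_size_invariant[of b' a'] by simp
  then show ?thesis
    unfolding lattice_size_def z by auto
qed


text \<open>
  From a low point, two steps and a magnification by the inverse of \<open>shrink\<close> amount to exchanging
  the coordinates and multiplying by \<open>1 + \<surd>2\<close>.
\<close>

lemma descent_low:
  assumes z: "(a, b) \<in> triangle" "sqrt 2 * a + b < sqrt 2 - 1"
  defines "z' \<equiv> ((1 + sqrt 2) * b, (1 + sqrt 2) * a)"
  shows "z' \<in> triangle" "eventually_periodic ret z' \<Longrightarrow> eventually_periodic ret (a, b)"
proof -
  have "(1 + sqrt 2) * (sqrt 2 * a + b) < (1 + sqrt 2) * (sqrt 2 - 1)"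
    using z sqrt2_bounds by (intro mult_strict_left_mono) auto
  then have "(1 + sqrt 2) * b + sqrt 2 * ((1 + sqrt 2) * a) < 1"
    by (simp add: expand)
  then show tri: "z' \<in> triangle"
    using z sqrt2_bounds by (simp add: z'_def triangle_def)
  assume "eventually_periodic ret z'"
  then have "eventually_periodic ret (shrink z')"
    using eventually_periodic_speedup[of triangle ret ret shrink z'] tri ret_in_triangle ret_renormalizes
    by blast
  moreover have "shrink z' = (ret ^^ 2) (a, b)"
    by (simp add: eval_nat_numeral ret_ret_low[OF z] shrink_def z'_def) (simp add: expand)
  ultimately show "eventually_periodic ret (a, b)"
    using eventually_periodic_funpow by metis
qed

lemma ret_ret_mid:
  "ret (ret (a, sqrt 2 - 1 - sqrt 2 * a)) = (sqrt 2 - 1 - sqrt 2 * a, a)"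
proof -
  have "ret (a, sqrt 2 - 1 - sqrt 2 * a) = (a + (sqrt 2 - 1), sqrt 2 - 1 - sqrt 2 * a)"
    by (rule ret_mid) simp
  moreover have "ret \<dots> = (sqrt 2 - 1 - sqrt 2 * a, a)"
    using sqrt2_bounds by (subst ret_high) (simp_all add: expand)
  ultimately show ?thesis by simp
qed

text \<open>
  On this segment of the middle line five steps reflect the segment in its midpoint. The endpoint
  with \<open>a = 3 - 2\<surd>2\<close> is fixed by two steps.
\<close>

lemma eventually_periodic_mid:
  assumes "0 < a" "a \<le> 3 - 2 * sqrt 2"
  shows "eventually_periodic ret (a, sqrt 2 - 1 - sqrt 2 * a)"
proof (cases "a = 3 - 2 * sqrt 2")
  case True
  then have "(ret ^^ 2) (a, sqrt 2 - 1 - sqrt 2 * a) = (a, sqrt 2 - 1 - sqrt 2 * a)"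
    by (simp add: eval_nat_numeral ret_ret_mid) (simp add: expand)
  then show ?thesis by (rule eventually_periodic_return) simp
next
  case False
  have five: "(ret ^^ 5) (x, sqrt 2 - 1 - sqrt 2 * x)
      = (3 - 2 * sqrt 2 - x, sqrt 2 - 1 - sqrt 2 * (3 - 2 * sqrt 2 - x))"
    if x: "0 < x" "x < 3 - 2 * sqrt 2" for x
  proof -
    have "sqrt 2 * (sqrt 2 - 1 - sqrt 2 * x) + x > sqrt 2 - 1"
      using x sqrt2_bounds by (simp add: expand)
    then have r3: "ret (sqrt 2 - 1 - sqrt 2 * x, x) = (x, 2 - sqrt 2)"
      by (subst ret_high) (simp_all add: expand)
    have "sqrt 2 * x > 0" using x by simp
    then have r4: "ret (x, 2 - sqrt 2) = (2 - sqrt 2, 3 - 2 * sqrt 2 - x)"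
      using sqrt2_bounds by (subst ret_high) (simp_all add: expand)
    have r5: "ret (2 - sqrt 2, 3 - 2 * sqrt 2 - x)
        = (3 - 2 * sqrt 2 - x, sqrt 2 - 1 - sqrt 2 * (3 - 2 * sqrt 2 - x))"
      using x sqrt2_bounds by (subst ret_high) (simp_all add: expand)
    have "(ret ^^ 5) y = ret (ret (ret (ret (ret y))))" for y
      by (simp add: eval_nat_numeral)
    then show ?thesis by (simp only: ret_ret_mid r3 r4 r5)
  qed
  let ?a = "3 - 2 * sqrt 2 - a"
  have "(ret ^^ (5 + 5)) (a, sqrt 2 - 1 - sqrt 2 * a) = (ret ^^ 5) (?a, sqrt 2 - 1 - sqrt 2 * ?a)"
    using five[of a] assms False by (simp only: funpow_add comp_apply)
  also have "\<dots> = (a, sqrt 2 - 1 - sqrt 2 * a)"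
    using five[of ?a] assms False by simp
  finally show ?thesis by (rule eventually_periodic_return) simp
qed

abbreviation (input) high :: "real \<times> real \<Rightarrow> bool" where
  "high z \<equiv> sqrt 2 * fst z + snd z > sqrt 2 - 1"

lemma descent_not_high:
  assumes tri: "z \<in> triangle" and size: "lattice_size z s" and nh: "\<not> high z"
  shows "eventually_periodic ret z \<or>
    (\<exists>z'\<in>triangle. \<exists>s'\<le>(sqrt 2 - 1) * s + (3 + 2 * sqrt 2). lattice_size z' s' \<and>
       (eventually_periodic ret z' \<longrightarrow> eventually_periodic ret z))"
proof -
  obtain a b where z: "z = (a, b)" by (cases z)
  show ?thesis
  proof (cases "sqrt 2 * a + b < sqrt 2 - 1")
    case True
    then show ?thesis
      using descent_low[of a b] lattice_size_swap[of a b s] tri size z by blast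
  next
    case False
    then have b: "b = sqrt 2 - 1 - sqrt 2 * a" using nh z by simp
    have a: "0 < a" using tri z by (simp add: triangle_def)
    show ?thesis
    proof (cases "a \<le> 3 - 2 * sqrt 2")
      case True
      then show ?thesis using eventually_periodic_mid[OF a] z b by simp
    next
      case False
      then have low: "sqrt 2 * b + a < sqrt 2 - 1"
        by (simp add: b expand)
      have rr: "(ret ^^ 2) z = (b, a)"
        by (simp add: eval_nat_numeral z b ret_ret_mid)
      then have tri': "(b, a) \<in> triangle"
        using funpow_in[of triangle ret z 2] ret_in_triangle tri by simp
      let ?z = "((1 + sqrt 2) * a, (1 + sqrt 2) * b)"
      have z': "?z = ((1 + sqrt 2) * a, 1 - (2 + sqrt 2) * a)"
        by (simp add: b expand)
      have "eventually_periodic ret ?z \<longrightarrow> eventually_periodic ret z"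
        using descent_low(2)[OF tri' low] rr eventually_periodic_funpow[of ret 2 z] by simp
      then show ?thesis
        using descent_low(1)[OF tri' low] lattice_size_line[of a s] size z b z' by metis
    qed
  qed
qed

text \<open>
  A point whose first eight iterates under \<open>turn\<close> are high is fixed by \<open>ret\<^sup>8\<close>. Otherwise it comes to a
  point that is not high, and on the way its size does not change.
\<close>

lemma descent:
  assumes tri: "z \<in> triangle" and size: "lattice_size z s"
  shows "eventually_periodic ret z \<or>
    (\<exists>z'\<in>triangle. \<exists>s'\<le>(sqrt 2 - 1) * s + (3 + 2 * sqrt 2). lattice_size z' s' \<and>
       (eventually_periodic ret z' \<longrightarrow> eventually_periodic ret z))"
proof -
  have chain: "(\<forall>i<n. high ((turn ^^ i) z)) \<Longrightarrow>
      (ret ^^ n) z = (turn ^^ n) z \<and> lattice_size ((turn ^^ n) z) s" for n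
  proof (induction n)
    case (Suc n)
    have "high ((turn ^^ n) z)" using Suc.prems by blast
    then have "ret ((turn ^^ n) z) = turn ((turn ^^ n) z)"
      by (cases "(turn ^^ n) z") (simp add: ret_high)
    moreover have "(ret ^^ n) z = (turn ^^ n) z" "lattice_size ((turn ^^ n) z) s"
      using Suc by auto
    ultimately show ?case
      using lattice_size_turn by simp
  qed (use size in simp)
  show ?thesis
  proof (cases "\<forall>i<8. high ((turn ^^ i) z)")
    case True
    then have "(ret ^^ 8) z = z" using chain[of 8] by (simp only: turn_order_8)
    then show ?thesis using eventually_periodic_return[of 8 ret z] by simp
  next
    case False
    then obtain n where n: "\<not> high ((turn ^^ n) z)" "\<forall>i<n. high ((turn ^^ i) z)"
      using exists_least_iff[of "\<lambda>i. \<not> high ((turn ^^ i) z)"] by blast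
    let ?w = "(ret ^^ n) z"
    have "?w \<in> triangle" using funpow_in[of triangle ret z n] ret_in_triangle tri by blast
    moreover have "lattice_size ?w s" "\<not> high ?w" using chain[OF n(2)] n(1) by simp_all
    ultimately show ?thesis
      using descent_not_high[of ?w s] eventually_periodic_funpow[of ret n z] by blast
  qed
qed

lemma conj_size_bound:
  assumes "conj_size a b \<le> 11"
  shows "\<bar>a - (1 + sqrt 2 / 2)\<bar> < 47 / 10" "\<bar>b - (1 + sqrt 2 / 2)\<bar> < 47 / 10"
proof -
  have *: "\<bar>v\<bar> < 47 / 10" if "u\<^sup>2 - sqrt 2 * u * v + v\<^sup>2 \<le> 11" for u v :: real
  proof (rule power2_less_imp_less)
    have "v\<^sup>2 \<le> 22"
      using that form_complete_square[of u v] zero_le_power2[of "u - sqrt 2 / 2 * v"] by linarith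
    then show "\<bar>v\<bar>\<^sup>2 < (47 / 10)\<^sup>2" by (simp add: power2_eq_square)
  qed simp
  show "\<bar>b - (1 + sqrt 2 / 2)\<bar> < 47 / 10"
    using assms by (intro *[of "a - (1 + sqrt 2 / 2)"]) (simp add: conj_size_def)
  show "\<bar>a - (1 + sqrt 2 / 2)\<bar> < 47 / 10"
    using assms by (intro *[of "b - (1 + sqrt 2 / 2)"]) (simp add: conj_size_def algebra_simps)
qed

text \<open>
  Discreteness: a number of \<open>\<int>[\<surd>2]\<close> in the unit interval whose conjugate is in a bounded interval
  has one of finitely many values.
\<close>

lemma small_coordinate:
  assumes "conjugates x x'" "0 < x" "x < 1" "\<bar>x' - (1 + sqrt 2 / 2)\<bar> < 47 / 10"
  shows "x = sqrt 2 - 1 \<and> x' = - sqrt 2 - 1 \<or> x = 2 - sqrt 2 \<and> x' = 2 + sqrt 2 \<or>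
    x = 3 - 2 * sqrt 2 \<and> x' = 3 + 2 * sqrt 2"
proof -
  obtain m n :: int where mn: "x = of_int m + of_int n * sqrt 2" "x' = of_int m - of_int n * sqrt 2"
    using assms(1) by (auto simp: conjugates_def)
  have "of_int m < (4 :: real)" "of_int m > (-2 :: real)"
    using assms(2-4) sqrt2_bounds unfolding mn by linarith+
  then have m: "m = -1 \<or> m = 0 \<or> m = 1 \<or> m = 2 \<or> m = 3" by linarith
  have "n < 2"
  proof (rule ccontr)
    assume "\<not> n < 2"
    then have "of_int n * sqrt 2 \<ge> 2 * sqrt 2" by (intro mult_right_mono) auto
    with m mn assms sqrt2_bounds show False by auto
  qed
  moreover have "n > -3"
  proof (rule ccontr)
    assume "\<not> n > -3"
    then have "of_int n * sqrt 2 \<le> (-3) * sqrt 2" by (intro mult_right_mono) auto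
    with m mn assms sqrt2_bounds show False by auto
  qed
  ultimately have "n = -2 \<or> n = -1 \<or> n = 0 \<or> n = 1" by linarith
  with m mn assms sqrt2_bounds show ?thesis by (elim disjE) simp_all
qed

text \<open>
  Of the nine pairs left by \<open>small_coordinate\<close>, five violate \<open>a + \<surd>2 b < 1\<close> and two have large
  conjugates. Of the remaining two points, the first is mapped to the second, which is fixed by two
  steps.
\<close>

lemma eventually_periodic_small:
  assumes tri: "z \<in> triangle" and size: "lattice_size z s" "s \<le> 11"
  shows "eventually_periodic ret z"
proof -
  obtain a b where z: "z = (a, b)" "0 < a" "0 < b" "a + sqrt 2 * b < 1"
    using tri by (auto simp: triangle_def)
  obtain a' b' where ab: "conjugates a a'" "conjugates b b'" "conj_size a' b' \<le> 11"
    using size z by (auto simp: lattice_size_def)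
  have "b < sqrt 2 * b" using z sqrt2_bounds by simp
  then have "a < 1" "b < 1" using z by linarith+
  note a = small_coordinate[OF ab(1) z(2) \<open>a < 1\<close> conj_size_bound(1)[OF ab(3)]]
  note b = small_coordinate[OF ab(2) z(3) \<open>b < 1\<close> conj_size_bound(2)[OF ab(3)]]
  have "conj_size (- sqrt 2 - 1) (3 + 2 * sqrt 2) = 29 + 41 / 2 * sqrt 2"
    "conj_size (3 + 2 * sqrt 2) (- sqrt 2 - 1) = 29 + 41 / 2 * sqrt 2"
    by (simp_all add: conj_size_def power2_eq_square expand add_divide_distrib)
  then have large: "\<not> conj_size (- sqrt 2 - 1) (3 + 2 * sqrt 2) \<le> 11"
    "\<not> conj_size (3 + 2 * sqrt 2) (- sqrt 2 - 1) \<le> 11"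
    using sqrt2_bounds by simp_all
  have ab': "\<not> (a' = - sqrt 2 - 1 \<and> b' = 3 + 2 * sqrt 2)" "\<not> (a' = 3 + 2 * sqrt 2 \<and> b' = - sqrt 2 - 1)"
    using ab(3) large by auto
  have "b \<noteq> 2 - sqrt 2"
  proof
    assume "b = 2 - sqrt 2"
    have "sqrt 2 * b = 2 * sqrt 2 - 2"
      unfolding \<open>b = 2 - sqrt 2\<close> by (simp add: expand)
    then have "a < 3 - 2 * sqrt 2" using z(4) by linarith
    then show False using a sqrt2_bounds by auto
  qed
  then have "z = (2 - sqrt 2, 3 - 2 * sqrt 2) \<or> z = (3 - 2 * sqrt 2, 3 - 2 * sqrt 2)"
  proof (cases "b = sqrt 2 - 1")
    case True
    have "sqrt 2 * b = 2 - sqrt 2"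
      unfolding True by (simp add: expand)
    then have "a < sqrt 2 - 1" using z(4) by linarith
    then show ?thesis using a b True ab' sqrt2_bounds by auto
  next
    case False
    then show ?thesis using a b \<open>b \<noteq> 2 - sqrt 2\<close> ab' z(1) by auto
  qed
  moreover have fixed: "eventually_periodic ret (3 - 2 * sqrt 2, 3 - 2 * sqrt 2)"
    using eventually_periodic_mid[of "3 - 2 * sqrt 2"] sqrt2_bounds by (simp add: expand)
  moreover have "ret (2 - sqrt 2, 3 - 2 * sqrt 2) = (3 - 2 * sqrt 2, 3 - 2 * sqrt 2)"
    using sqrt2_bounds by (subst ret_high) (simp_all add: expand)
  then have "eventually_periodic ret (2 - sqrt 2, 3 - 2 * sqrt 2)"
    using fixed eventually_periodic_funpow[of ret 1] by simp
  ultimately show ?thesis by blast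
qed

text \<open>
  The descent replaces a size \<open>s\<close> by at most \<open>(\<surd>2 - 1) s + 3 + 2\<surd>2\<close>, whose fixed point is just below 10.
  As \<open>\<surd>2 - 1\<close> is less than one half, each time the excess over 10 is at least halved.
\<close>

lemma eventually_periodic_lattice:
  assumes "z \<in> triangle" "lattice_size z s"
  shows "eventually_periodic ret z"
proof -
  have "z \<in> triangle \<Longrightarrow> lattice_size z s \<Longrightarrow> s \<le> 10 + 2 ^ m \<Longrightarrow> eventually_periodic ret z" for z s m
  proof (induction m arbitrary: z s)
    case 0
    then show ?case using eventually_periodic_small by simp
  next
    case (Suc m)
    have small: "s' \<le> 10 + 2 ^ m" if "s' \<le> (sqrt 2 - 1) * s + (3 + 2 * sqrt 2)" for s'
    proof -
      have "(sqrt 2 - 1) * s \<le> (sqrt 2 - 1) * (10 + 2 * 2 ^ m)"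
        using Suc.prems sqrt2_bounds by (intro mult_left_mono) auto
      also have "\<dots> \<le> 10 * (sqrt 2 - 1) + 2 ^ m"
        using mult_right_mono[of "2 * (sqrt 2 - 1)" 1 "2 ^ m :: real"] sqrt2_bounds
        by (simp add: algebra_simps)
      finally have "(sqrt 2 - 1) * s + (3 + 2 * sqrt 2) \<le> (12 * sqrt 2 - 7) + 2 ^ m" by simp
      also have "\<dots> \<le> 10 + 2 ^ m" using sqrt2_bounds by simp
      finally show ?thesis using that by (rule order_trans[rotated])
    qed
    from descent[OF Suc.prems(1,2)] show ?case
      using Suc.IH small by blast
  qed
  moreover obtain m :: nat where "s - 10 < 2 ^ m"
    using real_arch_pow[of 2 "s - 10"] by auto
  then have "s \<le> 10 + 2 ^ m" by linarith
  ultimately show ?thesis using assms by blast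
qed


section \<open>Powers of the rotation that return to the triangle\<close>

lemma rot_step:
  assumes "of_int n \<le> sqrt 2 * y - x" "sqrt 2 * y - x < of_int n + 1"
  shows "T (x, y) = (y, sqrt 2 * y - x - of_int n)"
proof -
  have "\<lfloor>sqrt 2 * y - x\<rfloor> = n" using assms by (simp add: floor_unique)
  then show ?thesis by (simp add: rot_map_def frac_def)
qed

lemma rot_0: "0 \<le> sqrt 2 * y - x \<Longrightarrow> sqrt 2 * y - x < 1 \<Longrightarrow> T (x, y) = (y, sqrt 2 * y - x)"
  and rot_neg: "-1 \<le> sqrt 2 * y - x \<Longrightarrow> sqrt 2 * y - x < 0 \<Longrightarrow> T (x, y) = (y, sqrt 2 * y - x + 1)"
  and rot_1: "1 \<le> sqrt 2 * y - x \<Longrightarrow> sqrt 2 * y - x < 2 \<Longrightarrow> T (x, y) = (y, sqrt 2 * y - x - 1)"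
  using rot_step[of 0 y x] rot_step[of "-1" y x] rot_step[of 1 y x] by simp_all

text \<open>
  The third power of the map on the points with \<open>\<surd>2 y < x\<close> that avoid the triangle; like \<open>turn\<close>
  it has order eight.
\<close>

abbreviation glide :: "real \<times> real \<Rightarrow> real \<times> real" where
  "glide \<equiv> \<lambda>(x, y). (y - sqrt 2 * x + sqrt 2, 1 - x)"

lemma glide_order_8: "(glide ^^ 8) z = z"
proof -
  have half: "(glide ^^ 4) (x, y) = (sqrt 2 - x, 2 - sqrt 2 - y)" for x y
  proof -
    have "glide (glide (x, y)) = (1 + x - sqrt 2 * y - 2 + sqrt 2, 1 - y + sqrt 2 * x - sqrt 2)"
      by (simp add: expand)
    then have "glide (glide (glide (glide (x, y)))) = (sqrt 2 - x, 2 - sqrt 2 - y)"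
      by (simp add: expand)
    then show ?thesis by (simp add: eval_nat_numeral)
  qed
  have "(glide ^^ (4 + 4)) z = z"
    by (cases z) (simp only: funpow_add comp_apply half, simp)
  then show ?thesis by simp
qed

lemma rot_three:
  assumes "sqrt 2 * y < x" "x < 1" "0 \<le> y" "sqrt 2 * x - y > sqrt 2 - 1"
  shows "(T ^^ 3) (x, y) = glide (x, y)"
proof -
  have y: "sqrt 2 * y \<ge> 0" using assms by simp
  have "sqrt 2 * x \<le> sqrt 2" using assms by simp
  then have "sqrt 2 * (sqrt 2 * y - x + 1) - y \<ge> 0" "sqrt 2 * (sqrt 2 * y - x + 1) - y < 1"
    using assms by (simp_all only: expand)
  then have 2: "T (y, sqrt 2 * y - x + 1) = (sqrt 2 * y - x + 1, y - sqrt 2 * x + sqrt 2)"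
    by (subst rot_0) (simp_all add: expand)
  have "0 < x" using assms(1) y by linarith
  then have 3: "T (sqrt 2 * y - x + 1, y - sqrt 2 * x + sqrt 2) = (y - sqrt 2 * x + sqrt 2, 1 - x)"
    using assms by (subst rot_0) (simp_all add: expand)
  have "T (x, y) = (y, sqrt 2 * y - x + 1)"
    using assms y by (intro rot_neg) linarith+
  with 2 3 show ?thesis by (simp add: eval_nat_numeral)
qed

text \<open>
  On the side \<open>y = 0\<close> the floor that follows these three steps is 0 instead of \<open>-1\<close>, and the fourth
  step leads back to that side.
\<close>

lemma rot_four:
  assumes "x < 1" "sqrt 2 * x > sqrt 2 - 1"
  shows "(T ^^ 4) (x, 0) = (1 - x, 0)"
proof -
  have "\<not> x \<le> 0"
    using assms sqrt2_bounds mult_nonneg_nonpos[of "sqrt 2" x] by auto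
  then have "(T ^^ 3) (x, 0) = (sqrt 2 - sqrt 2 * x, 1 - x)"
    using rot_three[of 0 x] assms by simp
  moreover have "T (sqrt 2 - sqrt 2 * x, 1 - x) = (1 - x, 0)"
    by (subst rot_0) (simp_all add: expand)
  ultimately show ?thesis by (simp add: eval_nat_numeral)
qed

lemma rot_chart:
  assumes "0 \<le> a" "0 < b" "a + sqrt 2 * b \<le> 1"
  shows "T (chart (a, b)) = (1 - (sqrt 2 - 1) * b, (sqrt 2 - 1) * (1 - a - sqrt 2 * b))"
proof -
  have "(sqrt 2 - 1) * (1 - a - sqrt 2 * b) \<ge> 0" "(sqrt 2 - 1) * a \<ge> 0" "(sqrt 2 - 1) * b > 0"
    "sqrt 2 * ((sqrt 2 - 1) * b) > 0"
    using assms sqrt2_bounds by simp_all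
  then have "1 \<le> sqrt 2 * (1 - (sqrt 2 - 1) * b) - (sqrt 2 - 1) * a"
    "sqrt 2 * (1 - (sqrt 2 - 1) * b) - (sqrt 2 - 1) * a < 2"
    using assms sqrt2_bounds by (simp_all only: expand)
  then show ?thesis
    unfolding chart_def by (simp add: rot_1) (simp add: expand)
qed

lemma chart_glide:
  assumes "0 \<le> a" "0 < b" "a + sqrt 2 * b < 1"
  shows "(T ^^ 3) (1 - (sqrt 2 - 1) * b, (sqrt 2 - 1) * (1 - a - sqrt 2 * b))
    = ((sqrt 2 - 1) * (1 - a), (sqrt 2 - 1) * b)"
proof -
  let ?k = "sqrt 2 - 1 :: real" and ?c = "1 - a - sqrt 2 * b"
  have pos: "?k * ?c > 0" "?k * a \<ge> 0" "?k * b > 0" "sqrt 2 * a \<ge> 0"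
    using assms sqrt2_bounds by simp_all
  have 1: "sqrt 2 * (?k * ?c) < 1 - ?k * b"
    using pos assms sqrt2_bounds by (simp only: expand)
  have 2: "sqrt 2 * (1 - ?k * b) - ?k * ?c > ?k"
    using pos assms sqrt2_bounds by (simp only: expand)
  show ?thesis
    using rot_three[OF 1 _ _ 2] pos by (simp add: expand)
qed

lemma chart_five:
  assumes "0 \<le> a" "0 < b" "a + sqrt 2 * b < 1"
  shows "(T ^^ 5) (chart (a, b)) = chart (b, 1 - a - sqrt 2 * b)"
proof -
  let ?k = "sqrt 2 - 1 :: real" and ?c = "1 - a - sqrt 2 * b"
  have pos: "?k * ?c > 0" "?k * a \<ge> 0" "sqrt 2 * (?k * b) > 0"
    using assms sqrt2_bounds by simp_all
  have "sqrt 2 * (?k * b) - ?k * (1 - a) < 0" "sqrt 2 * (?k * b) - ?k * (1 - a) \<ge> - 1"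
    using pos sqrt2_bounds by (simp_all only: expand)
  then have 5: "T (?k * (1 - a), ?k * b) = chart (b, ?c)"
    unfolding chart_def by (simp add: rot_neg) (simp add: expand)
  have "(T ^^ 5) z = T ((T ^^ 3) (T z))" for z
    by (simp add: eval_nat_numeral)
  then show ?thesis
    using rot_chart[of a b] assms chart_glide[of a b] 5 by simp
qed

lemma chart_six:
  assumes "0 \<le> a" "0 < b" "a + sqrt 2 * b = 1"
  shows "(T ^^ 6) (chart (a, b)) = chart (0, b)"
proof -
  let ?k = "sqrt 2 - 1 :: real"
  have pos: "?k * b > 0"
    using assms sqrt2_bounds by simp
  have "?k * (sqrt 2 * b) \<le> ?k * 1"
    using assms sqrt2_bounds by (intro mult_left_mono) auto
  then have le: "sqrt 2 * (?k * b) \<le> ?k" by (simp only: mult.left_commute mult_1_right)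
  then have "sqrt 2 * (1 - ?k * b) > ?k"
    unfolding right_diff_distrib[of "sqrt 2"] using sqrt2_bounds by linarith
  then have 5: "(T ^^ 4) (1 - ?k * b, 0) = (?k * b, 0)"
    using rot_four[of "1 - ?k * b"] pos by simp
  have "1 * (?k * b) < sqrt 2 * (?k * b)"
    using pos sqrt2_bounds by (intro mult_strict_right_mono) auto
  then have "?k * b \<le> 1" using le sqrt2_bounds by linarith
  then have 6: "T (?k * b, 0) = chart (0, b)"
    unfolding chart_def using pos by (subst rot_neg) simp_all
  have "(T ^^ 6) z = T ((T ^^ 4) (T z))" for z
    by (simp add: eval_nat_numeral)
  moreover have "T (chart (a, b)) = (1 - ?k * b, 0)"
    using rot_chart[of a b] assms by simp
  ultimately show ?thesis using 5 6 by simp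
qed

text \<open>After one step the orbit makes four glides inside the region \<open>\<surd>2 y < x\<close> before it returns.\<close>

lemma chart_fourteen:
  assumes "0 \<le> a" "0 < b" "sqrt 2 * a + b < sqrt 2 - 1"
  shows "(T ^^ 14) (chart (a, b)) = chart (a + sqrt 2 * b + (sqrt 2 - 1), sqrt 2 - 1 - sqrt 2 * a - b)"
proof -
  let ?k = "sqrt 2 - 1 :: real" and ?c = "1 - a - sqrt 2 * b" and ?e = "sqrt 2 - 1 - sqrt 2 * a - b"
  have pos: "?k * ?e > 0" "?k * a \<ge> 0" "?k * b > 0" "sqrt 2 * (?k * b) > 0" "sqrt 2 * (?k * ?e) > 0" "sqrt 2 * a \<ge> 0"
      "sqrt 2 * ?e > 0" "b * sqrt 2 > 0"
    using assms sqrt2_bounds by simp_all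
  have c: "?c > 0"
    using pos(7) assms sqrt2_bounds by (simp only: expand)
  have posc: "?k * ?c > 0" "sqrt 2 * (?k * ?c) > 0" using c sqrt2_bounds by simp_all
  have 1: "sqrt 2 * (?k * b) < ?k * (1 - a)" "sqrt 2 * (?k * (1 - a)) - ?k * b > ?k"
    using pos posc sqrt2_bounds by (simp_all only: expand)
  have g2: "(T ^^ 3) (?k * (1 - a), ?k * b) = (1 - ?k * ?e, 1 - ?k + ?k * a)"
    using rot_three[OF 1(1) _ _ 1(2)] pos sqrt2_bounds by (simp add: expand)
  have 2: "sqrt 2 * (1 - ?k + ?k * a) < 1 - ?k * ?e" "sqrt 2 * (1 - ?k * ?e) - (1 - ?k + ?k * a) > ?k"
    using pos posc sqrt2_bounds by (simp_all only: expand)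
  have g3: "(T ^^ 3) (1 - ?k * ?e, 1 - ?k + ?k * a) = (?k * (1 + ?c), ?k * ?e)"
    using rot_three[OF 2(1) _ _ 2(2)] pos sqrt2_bounds by (simp add: expand)
  have 3: "sqrt 2 * (?k * ?e) < ?k * (1 + ?c)" "sqrt 2 * (?k * (1 + ?c)) - ?k * ?e > ?k"
    "?k * (1 + ?c) < 1"
    using pos posc sqrt2_bounds by (simp_all only: expand)
  have g4: "(T ^^ 3) (?k * (1 + ?c), ?k * ?e) = (?k * (1 + b), 1 - ?k * (1 + ?c))"
    using rot_three[OF 3(1,3) _ 3(2)] pos sqrt2_bounds by (simp add: expand)
  have "sqrt 2 * (1 - ?k * (1 + ?c)) - ?k * (1 + b) < 0"
    "sqrt 2 * (1 - ?k * (1 + ?c)) - ?k * (1 + b) \<ge> -1"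
    using pos posc sqrt2_bounds by (simp_all only: expand)
  then have t: "T (?k * (1 + b), 1 - ?k * (1 + ?c)) = chart (a + sqrt 2 * b + ?k, ?e)"
    unfolding chart_def by (simp add: rot_neg) (simp add: expand)
  have "(T ^^ 14) z = T ((T ^^ 3) ((T ^^ 3) ((T ^^ 3) ((T ^^ 3) (T z)))))" for z
    by (simp add: eval_nat_numeral)
  moreover have "T (chart (a, b)) = (1 - ?k * b, ?k * ?c)"
    using rot_chart[of a b] assms c by simp
  moreover have "(T ^^ 3) (1 - ?k * b, ?k * ?c) = (?k * (1 - a), ?k * b)"
    using chart_glide[of a b] assms c by simp
  ultimately show ?thesis
    by (simp only: g2 g3 g4 t)
qed

lemma rot_speeds_up_ret:
  assumes "z \<in> triangle"
  shows "\<exists>k>0. (T ^^ k) (chart z) = chart (ret z)"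
proof -
  obtain a b where z: "z = (a, b)" "0 < a" "0 < b" "a + sqrt 2 * b < 1"
    using assms by (auto simp: triangle_def)
  consider "high z" | "sqrt 2 * a + b < sqrt 2 - 1" | "sqrt 2 * a + b = sqrt 2 - 1"
    using z by fastforce
  then show ?thesis
  proof cases
    case 1
    then show ?thesis
      using chart_five[of a b] z by (intro exI[of _ 5]) (simp add: ret_high)
  next
    case 2
    then show ?thesis
      using chart_fourteen[of a b] z by (intro exI[of _ 14]) (simp add: ret_low)
  next
    case 3
    then have b: "b = sqrt 2 - 1 - sqrt 2 * a" by simp
    let ?c = "1 - a - sqrt 2 * b"
    have c: "?c > 0" using z by simp
    have bc: "b + sqrt 2 * ?c = 1" by (simp add: b expand)
    have "(T ^^ 5) (chart z) = chart (b, ?c)"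
      using chart_five[of a b] z by simp
    moreover have "(T ^^ 6) (chart (b, ?c)) = chart (0, ?c)"
      using chart_six[of b ?c] z c bc by simp
    moreover have "(T ^^ 5) (chart (0, ?c)) = chart (?c, 1 - sqrt 2 * ?c)"
      using chart_five[of 0 ?c] z c bc by simp
    moreover have "(?c, 1 - sqrt 2 * ?c) = ret z"
      using ret_mid[OF 3] bc z by (simp add: b expand)
    ultimately have "(T ^^ (5 + (6 + 5))) (chart z) = chart (ret z)"
      by (simp only: funpow_add comp_apply)
    then show ?thesis by (intro exI[of _ "5 + (6 + 5)"]) simp
  qed
qed

text \<open>
  A point of the side \<open>a = 0\<close> enters the interior if \<open>b > \<surd>2 - 1\<close>. Otherwise it returns to this
  side by way of the side \<open>a + \<surd>2 b = 1\<close>: it is fixed by the return if \<open>b = \<surd>2 - 1\<close>, and \<open>b\<close> is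
  replaced by \<open>\<surd>2 - 1 - b\<close>, an involution, if \<open>b < \<surd>2 - 1\<close>.
\<close>

lemma edge_left:
  assumes "0 < b" "sqrt 2 * b < 1"
  shows "eventually_periodic T (chart (0, b)) \<or> (\<exists>k. \<exists>w\<in>triangle. (T ^^ k) (chart (0, b)) = chart w)"
proof -
  consider "b > sqrt 2 - 1" | "b = sqrt 2 - 1" | "b < sqrt 2 - 1" by linarith
  then show ?thesis
  proof cases
    case 1
    then have "(b, 1 - sqrt 2 * b) \<in> triangle" "(T ^^ 5) (chart (0, b)) = chart (b, 1 - sqrt 2 * b)"
      using chart_five[of 0 b] assms by (simp_all add: triangle_def expand)
    then show ?thesis by metis
  next
    case 2
    have "(T ^^ 5) (chart (0, b)) = chart (b, b)" "(T ^^ 6) (chart (b, b)) = chart (0, b)"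
      using chart_five[of 0 b] chart_six[of b b] assms by (simp_all add: 2 expand)
    then have "(T ^^ (6 + 5)) (chart (0, b)) = chart (0, b)"
      by (simp only: funpow_add comp_apply)
    then show ?thesis using eventually_periodic_return[of "6 + 5" T] by simp
  next
    case 3
    have *: "(T ^^ (6 + 14)) (chart (0, x)) = chart (0, sqrt 2 - 1 - x)"
      if "0 < x" "x < sqrt 2 - 1" for x
    proof -
      have "(T ^^ 14) (chart (0, x)) = chart (sqrt 2 * x + (sqrt 2 - 1), sqrt 2 - 1 - x)"
        using chart_fourteen[of 0 x] that by simp
      moreover have "sqrt 2 * x + (sqrt 2 - 1) \<ge> 0"
        using that sqrt2_bounds by (intro add_nonneg_nonneg) auto
      then have "(T ^^ 6) (chart (sqrt 2 * x + (sqrt 2 - 1), sqrt 2 - 1 - x)) = chart (0, sqrt 2 - 1 - x)"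
        using that by (intro chart_six) (simp_all add: expand)
      ultimately show ?thesis by (simp only: funpow_add comp_apply)
    qed
    have "(T ^^ ((6 + 14) + (6 + 14))) (chart (0, b)) = chart (0, b)"
      using *[of b] *[of "sqrt 2 - 1 - b"] assms 3 by (subst funpow_add) simp
    then show ?thesis using eventually_periodic_return[of "(6 + 14) + (6 + 14)" T] by simp
  qed
qed

lemma closed_triangle:
  assumes "0 \<le> a" "0 < b" "a + sqrt 2 * b \<le> 1"
  shows "eventually_periodic T (chart (a, b)) \<or> (\<exists>k. \<exists>w\<in>triangle. (T ^^ k) (chart (a, b)) = chart w)"
proof (cases "a + sqrt 2 * b = 1")
  case True
  have six: "(T ^^ 6) (chart (a, b)) = chart (0, b)" using chart_six assms True by simp
  show ?thesis
  proof (cases "a = 0")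
    case True
    then show ?thesis using six eventually_periodic_return[of 6 T] by simp
  next
    case False
    then have "sqrt 2 * b < 1" using assms True by simp
    from edge_left[OF assms(2) this] show ?thesis
      using six eventually_periodic_funpow[of T 6 "chart (a, b)"]
      by (metis comp_apply funpow_add)
  qed
next
  case False
  show ?thesis
  proof (cases "a = 0")
    case True
    then show ?thesis using edge_left assms False by simp
  next
    case a: False
    then have "(a, b) \<in> triangle" using assms False by (simp add: triangle_def)
    then show ?thesis by (metis funpow_0)
  qed
qed


section \<open>Orbits that avoid the triangle\<close>

definition avoiding :: "(real \<times> real) set" where
  "avoiding = {z \<in> unit_square. \<forall>k. sqrt 2 * snd ((T ^^ k) z) - fst ((T ^^ k) z) < 1}"

lemma avoiding_funpow:
  assumes "z \<in> avoiding"
  shows "(T ^^ k) z \<in> avoiding"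
proof -
  have "(T ^^ k) z \<in> unit_square"
    using assms funpow_in[of unit_square T z k] bij_betw_apply[OF bij_betw_rot_map]
    by (auto simp: avoiding_def)
  moreover have "(T ^^ n) ((T ^^ k) z) = (T ^^ (n + k)) z" for n
    by (simp add: funpow_add)
  ultimately show ?thesis using assms by (simp add: avoiding_def)
qed

lemma avoidingD:
  assumes "(x, y) \<in> avoiding"
  shows "0 \<le> x" "x < 1" "0 \<le> y" "y < 1" "sqrt 2 * y - x < 1"
proof -
  have "(x, y) \<in> unit_square" using assms by (simp add: avoiding_def)
  then show "0 \<le> x" "x < 1" "0 \<le> y" "y < 1" by (simp_all add: unit_square_def)
  have "sqrt 2 * snd ((T ^^ 0) (x, y)) - fst ((T ^^ 0) (x, y)) < 1"
    using assms unfolding avoiding_def by blast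
  then show "sqrt 2 * y - x < 1" by simp
qed

lemma avoiding_steps:
  assumes av: "(x, y) \<in> avoiding" and neg: "sqrt 2 * y < x"
  shows "sqrt 2 * x - y > sqrt 2 - 1" "(T ^^ 3) (x, y) = glide (x, y)"
proof -
  have y: "sqrt 2 * y \<ge> 0" using avoidingD[OF av] by simp
  have "T (x, y) = (y, sqrt 2 * y - x + 1)"
    using avoidingD[OF av] neg y by (intro rot_neg) linarith+
  then have "sqrt 2 * (sqrt 2 * y - x + 1) - y < 1"
    using avoidingD(5)[of y "sqrt 2 * y - x + 1"] avoiding_funpow[OF av, of 1] by simp
  then show *: "sqrt 2 * x - y > sqrt 2 - 1" by (simp add: expand)
  show "(T ^^ 3) (x, y) = glide (x, y)"
    using rot_three[OF neg _ _ *] avoidingD[OF av] by simp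
qed

lemma avoiding_bottom:
  assumes av: "(x, 0) \<in> avoiding" and x: "0 < x"
  shows "eventually_periodic T (x, 0)"
proof -
  have four: "(T ^^ 4) (u, 0) = (1 - u, 0)" if "(u, 0) \<in> avoiding" "0 < u" for u
    using rot_four[of u] avoiding_steps(1)[of u 0] avoidingD[of u 0] that by simp
  have "(1 - x, 0) \<in> avoiding" using four[OF assms] avoiding_funpow[OF av, of 4] by simp
  then have "(T ^^ (4 + 4)) (x, 0) = (x, 0)"
    using four[OF assms] four[of "1 - x"] avoidingD(2)[OF av]
    by (subst funpow_add) simp
  then show ?thesis using eventually_periodic_return[of "4 + 4" T] by simp
qed

text \<open>
  A glide leads back to the region \<open>\<surd>2 y < x\<close> as long as \<open>y > 0\<close>. So either there are eight glides
  in a row, which return to the start, or the orbit comes to the side \<open>y = 0\<close>, on which \<open>T\<^sup>4\<close> acts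
  as an involution.
\<close>

lemma avoiding_negative:
  assumes av: "z \<in> avoiding" and neg: "sqrt 2 * snd z < fst z"
  shows "eventually_periodic T z"
proof -
  have chain: "(\<forall>i<n. snd ((glide ^^ i) z) > 0) \<Longrightarrow>
      (T ^^ (3 * n)) z = (glide ^^ n) z \<and> sqrt 2 * snd ((glide ^^ n) z) < fst ((glide ^^ n) z)" for n
  proof (induction n)
    case (Suc n)
    obtain x y where xy: "(glide ^^ n) z = (x, y)" by (cases "(glide ^^ n) z")
    have "\<forall>i<n. snd ((glide ^^ i) z) > 0" using Suc.prems less_SucI by blast
    from Suc.IH[OF this] have IH: "(T ^^ (3 * n)) z = (x, y)" "sqrt 2 * y < x"
      unfolding xy by simp_all
    have "snd ((glide ^^ n) z) > 0" using Suc.prems lessI by blast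
    then have y: "y > 0" unfolding xy by simp
    have "(x, y) \<in> avoiding" using avoiding_funpow[OF av, of "3 * n"] unfolding IH .
    then have "(T ^^ (3 + 3 * n)) z = glide (x, y)"
      using avoiding_steps(2) IH by (simp only: funpow_add comp_apply)
    moreover have "(glide ^^ Suc n) z = glide (x, y)" by (simp only: funpow.simps comp_apply xy)
    moreover have "3 * Suc n = 3 + 3 * n" by simp
    ultimately have "(T ^^ (3 * Suc n)) z = (glide ^^ Suc n) z" by (simp only:)
    moreover have "sqrt 2 * snd (glide (x, y)) < fst (glide (x, y))"
      using y by (simp add: algebra_simps)
    ultimately show ?case using \<open>(glide ^^ Suc n) z = glide (x, y)\<close> by (simp only:)
  qed (use neg in simp)
  show ?thesis
  proof (cases "\<forall>i<8. snd ((glide ^^ i) z) > 0")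
    case True
    then have "(T ^^ (3 * 8)) z = z" using chain[of 8] by (simp only: glide_order_8)
    then show ?thesis using eventually_periodic_return[of "3 * 8" T] by simp
  next
    case False
    then obtain n where n: "\<not> snd ((glide ^^ n) z) > 0" "\<forall>i<n. snd ((glide ^^ i) z) > 0"
      using exists_least_iff[of "\<lambda>i. \<not> snd ((glide ^^ i) z) > 0"] by blast
    obtain x y where xy: "(T ^^ (3 * n)) z = (x, y)" by (cases "(T ^^ (3 * n)) z")
    have av': "(x, y) \<in> avoiding" using avoiding_funpow[OF av, of "3 * n"] unfolding xy .
    have glide: "(glide ^^ n) z = (x, y)" "sqrt 2 * y < x"
      using chain[OF n(2)] unfolding xy by (metis, metis fst_conv snd_conv)
    have "y = 0" using n(1) avoidingD(3)[OF av'] unfolding glide(1) by simp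
    then have "eventually_periodic T (x, y)"
      using avoiding_bottom[of x] av' glide(2) by simp
    then show ?thesis
      using eventually_periodic_funpow[of T "3 * n" z] unfolding xy by blast
  qed
qed

text \<open>
  Three steps with floor 0 in a row would produce the second coordinate \<open>- x\<close>. So unless \<open>x = 0\<close> the
  region \<open>\<surd>2 y < x\<close> is reached within two steps, and points with \<open>x = 0\<close> come to the side \<open>y = 0\<close>.
\<close>

lemma avoiding_eventually_periodic:
  assumes av: "z \<in> avoiding"
  shows "eventually_periodic T z"
proof -
  obtain x y where z: "z = (x, y)" by (cases z)
  have av0: "(x, y) \<in> avoiding" using av unfolding z .
  have reach: ?thesis if "(T ^^ k) z = (u, v)" "sqrt 2 * v < u" for k u v
    by (rule eventually_periodic_funpow[of T k], rule avoiding_negative[OF avoiding_funpow[OF av]])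
      (simp add: that)
  have step: "T (u, v) = (v, sqrt 2 * v - u)" if "(u, v) \<in> avoiding" "\<not> sqrt 2 * v < u" for u v
    using avoidingD(5)[OF that(1)] that(2) by (intro rot_0) linarith+
  show ?thesis
  proof (cases "sqrt 2 * y < x")
    case True
    then show ?thesis using reach[of 0 x y] z by simp
  next
    case False
    then have 1: "(T ^^ 1) z = (y, sqrt 2 * y - x)"
      using step[OF av0] unfolding z by simp
    then have av1: "(y, sqrt 2 * y - x) \<in> avoiding" using avoiding_funpow[OF av, of 1] by simp
    show ?thesis
    proof (cases "sqrt 2 * (sqrt 2 * y - x) < y")
      case True
      then show ?thesis using reach[OF 1] by simp
    next
      case False
      have "(T ^^ Suc 1) z = T (y, sqrt 2 * y - x)" unfolding funpow.simps(2) comp_apply 1 ..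
      also have "\<dots> = (sqrt 2 * y - x, y - sqrt 2 * x)"
        using step[OF av1 False] by (simp add: expand)
      finally have 2: "(T ^^ 2) z = (sqrt 2 * y - x, y - sqrt 2 * x)" by (simp only: Suc_1)
      show ?thesis
      proof (cases "x = 0")
        case False
        then have "sqrt 2 * (y - sqrt 2 * x) < sqrt 2 * y - x"
          using avoidingD(1)[OF av0] by (simp add: expand)
        then show ?thesis using reach[OF 2] by simp
      next
        case x: True
        then have av2: "(sqrt 2 * y, y) \<in> avoiding" and 2: "(T ^^ 2) z = (sqrt 2 * y, y)"
          using avoiding_funpow[OF av, of 2] 2 by simp_all
        have "(T ^^ Suc 2) z = T (sqrt 2 * y, y)" unfolding funpow.simps(2) comp_apply 2 ..
        also have "\<dots> = (y, 0)" using step[OF av2] by simp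
        finally have 3: "(T ^^ Suc 2) z = (y, 0)" .
        show ?thesis
        proof (cases "y = 0")
          case True
          then have "(T ^^ 1) z = z" unfolding 1 unfolding z using x by simp
          then show ?thesis by (rule eventually_periodic_return) simp
        next
          case False
          then show ?thesis using reach[OF 3] avoidingD(3)[OF av0] by simp
        qed
      qed
    qed
  qed
qed

section \<open>Periodicity on the lattice\<close>

lemma Z_sqrt2_iff: "x \<in> Z_sqrt2 \<longleftrightarrow> (\<exists>x'. conjugates x x')"
  by (auto simp: Z_sqrt2_def conjugates_def)

lemma rot_lattice:
  assumes "z \<in> Z_sqrt2 \<times> Z_sqrt2"
  shows "T z \<in> Z_sqrt2 \<times> Z_sqrt2"
proof -
  obtain x y x' y' where z: "z = (x, y)" "conjugates x x'" "conjugates y y'"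
    using assms by (auto simp: Z_sqrt2_iff)
  have "conjugates (sqrt 2 * y - x - of_int \<lfloor>- x + sqrt 2 * y\<rfloor>)
      ((- sqrt 2) * y' - x' - of_int \<lfloor>- x + sqrt 2 * y\<rfloor>)"
    using z by (intro conjugates_intros) simp_all
  moreover have "T z = (y, sqrt 2 * y - x - of_int \<lfloor>- x + sqrt 2 * y\<rfloor>)"
    using z by (simp add: rot_map_def frac_def)
  ultimately show ?thesis using z(3) by (auto simp: Z_sqrt2_iff)
qed

lemma chart_lattice_size:
  assumes "chart w \<in> Z_sqrt2 \<times> Z_sqrt2"
  shows "\<exists>s. lattice_size w s"
proof -
  obtain a b where w: "w = (a, b)" by (cases w)
  obtain u v where uv: "conjugates ((sqrt 2 - 1) * a) u" "conjugates (1 - (sqrt 2 - 1) * b) v"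
    using assms w by (auto simp: chart_def Z_sqrt2_iff)
  have "conjugates ((1 + sqrt 2) * ((sqrt 2 - 1) * a)) ((1 + - sqrt 2) * u)"
    "conjugates ((1 + sqrt 2) * (1 - (1 - (sqrt 2 - 1) * b))) ((1 + - sqrt 2) * (1 - v))"
    using uv by (intro conjugates_intros; simp)+
  moreover have "(1 + sqrt 2) * ((sqrt 2 - 1) * a) = a"
    "(1 + sqrt 2) * (1 - (1 - (sqrt 2 - 1) * b)) = b"
    by (simp_all add: expand)
  ultimately have "conjugates a ((1 + - sqrt 2) * u)" "conjugates b ((1 + - sqrt 2) * (1 - v))"
    by (simp_all only:)
  then show ?thesis unfolding lattice_size_def w by auto
qed

lemma rot_periodic_lattice:
  assumes sq: "z \<in> unit_square" and lat: "z \<in> Z_sqrt2 \<times> Z_sqrt2"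
  shows "eventually_periodic T z"
proof (cases "z \<in> avoiding")
  case True
  then show ?thesis by (rule avoiding_eventually_periodic)
next
  case False
  then obtain k where k: "1 \<le> sqrt 2 * snd ((T ^^ k) z) - fst ((T ^^ k) z)"
    using sq by (auto simp: avoiding_def not_less)
  obtain x y where xy: "(T ^^ k) z = (x, y)" by (cases "(T ^^ k) z")
  have "(x, y) \<in> unit_square"
    using funpow_in[of unit_square T z k] bij_betw_apply[OF bij_betw_rot_map] sq xy by auto
  then have box: "0 \<le> x" "y < 1" by (auto simp: unit_square_def)
  \<comment> \<open>The inverse of \<open>chart\<close>, since \<open>1 + \<surd>2\<close> is the inverse of \<open>\<surd>2 - 1\<close>.\<close>
  let ?a = "(1 + sqrt 2) * x" and ?b = "(1 + sqrt 2) * (1 - y)"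
  have chart: "chart (?a, ?b) = (x, y)"
    by (simp add: chart_def expand)
  have "(1 + sqrt 2) * (x + sqrt 2 * (1 - y)) \<le> (1 + sqrt 2) * (sqrt 2 - 1)"
    using k xy by (intro mult_left_mono) (simp_all add: expand)
  then have "?a + sqrt 2 * ?b \<le> 1" by (simp add: expand)
  moreover have "0 \<le> ?a" "0 < ?b" using box by (simp_all add: add_pos_nonneg)
  ultimately consider "eventually_periodic T (x, y)"
    | j w where "w \<in> triangle" "(T ^^ j) (x, y) = chart w"
    using closed_triangle[of ?a ?b] unfolding chart by blast
  then have "eventually_periodic T (x, y)"
  proof cases
    case (2 j w)
    have "chart w = (T ^^ (j + k)) z" using 2 xy by (simp add: funpow_add)
    then have "chart w \<in> Z_sqrt2 \<times> Z_sqrt2"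
      using funpow_in[of "Z_sqrt2 \<times> Z_sqrt2" T z "j + k"] rot_lattice lat by simp
    from chart_lattice_size[OF this] obtain s where "lattice_size w s" by blast
    then have "eventually_periodic ret w" by (rule eventually_periodic_lattice[OF 2(1)])
    then have "eventually_periodic T (chart w)"
      using eventually_periodic_speedup[of triangle ret T chart w] ret_in_triangle
        rot_speeds_up_ret 2(1) by blast
    then show ?thesis using eventually_periodic_funpow[of T j "(x, y)"] 2(2) by simp
  qed
  then show ?thesis using eventually_periodic_funpow[of T k z] xy by simp
qed

section \<open>A point with an infinite orbit\<close>

lemma shrink_funpow_in_triangle: "z \<in> triangle \<Longrightarrow> (shrink ^^ m) z \<in> triangle"
  using funpow_in[of triangle shrink] shrink_in_triangle by blast

lemma snd_shrink_funpow: "snd ((shrink ^^ m) z) = (sqrt 2 - 1) ^ m * snd z"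
  by (induction m) (simp_all add: shrink_def split_beta)

lemma shrink_funpow_reaches:
  assumes "z \<in> triangle"
  shows "\<exists>k. (ret ^^ k) ((shrink ^^ m) z) = (shrink ^^ m) ((ret ^^ j) z)"
proof (induction m)
  case (Suc m)
  then obtain k where k: "(ret ^^ k) ((shrink ^^ m) z) = (shrink ^^ m) ((ret ^^ j) z)" by blast
  obtain l where "(ret ^^ l) (shrink ((shrink ^^ m) z)) = shrink ((ret ^^ k) ((shrink ^^ m) z))"
    using speedup_reaches[of triangle ret ret shrink "(shrink ^^ m) z" k] ret_in_triangle
      ret_renormalizes shrink_funpow_in_triangle[OF assms] by blast
  then show ?case using k by auto
qed auto

lemma self_similar_orbit:
  assumes z: "z \<in> triangle" and self: "(ret ^^ j) z = (shrink ^^ m) z"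
  shows "\<exists>k. (ret ^^ k) z = (shrink ^^ (n * m)) z"
proof (induction n)
  case 0
  show ?case by (rule exI[of _ 0]) simp
next
  case (Suc n)
  then obtain k where k: "(ret ^^ k) z = (shrink ^^ (n * m)) z" by blast
  obtain l where "(ret ^^ l) ((shrink ^^ (n * m)) z) = (shrink ^^ (n * m)) ((shrink ^^ m) z)"
    using shrink_funpow_reaches[OF z, of "n * m" j] self by auto
  then have "(ret ^^ (l + k)) z = (shrink ^^ (n * m + m)) z"
    using k by (simp add: funpow_add)
  then show ?case by (auto simp: add.commute)
qed

lemma self_similar_not_periodic:
  assumes z: "z \<in> triangle" and self: "(ret ^^ j) z = (shrink ^^ m) z" and m: "m > 0"
    and p: "p > 0"
  shows "(T ^^ p) (chart z) \<noteq> chart z"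
proof
  assume per: "(T ^^ p) (chart z) = chart z"
  let ?f = "\<lambda>n. chart ((shrink ^^ (n * m)) z)"
  have "?f n \<in> (\<lambda>k. (T ^^ k) (chart z)) ` {..<p}" for n
  proof -
    obtain k where "(ret ^^ k) z = (shrink ^^ (n * m)) z"
      using self_similar_orbit[OF z self] by blast
    moreover obtain l where "(T ^^ l) (chart z) = chart ((ret ^^ k) z)"
      using speedup_reaches[of triangle ret T chart z k] ret_in_triangle rot_speeds_up_ret z by blast
    ultimately have "?f n = (T ^^ (l mod p)) (chart z)"
      using funpow_mod_eq[OF per, of l] by simp
    then show ?thesis using p by auto
  qed
  then have "finite (range ?f)"
    by (metis (no_types, lifting) finite_imageI finite_lessThan finite_subset image_subsetI)
  moreover have "inj ?f"
  proof (rule injI)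
    fix i n assume "?f i = ?f n"
    then have "snd ((shrink ^^ (i * m)) z) = snd ((shrink ^^ (n * m)) z)"
      using sqrt2_bounds by (simp add: chart_def split_beta)
    moreover have "snd z > 0" using z by (auto simp: triangle_def)
    ultimately have "(sqrt 2 - 1 :: real) ^ (i * m) = (sqrt 2 - 1) ^ (n * m)"
      by (simp add: snd_shrink_funpow)
    then have "i * m = n * m"
      using sqrt2_bounds power_strict_decreasing[of "i * m" "n * m" "sqrt 2 - 1"]
        power_strict_decreasing[of "n * m" "i * m" "sqrt 2 - 1"]
      by (cases "i * m" "n * m" rule: linorder_cases) auto
    then show "i = n" using m by simp
  qed
  ultimately show False using finite_imageD by blast
qed

text \<open>
  Magnifying \<open>ret z\<close> three times gives \<open>w\<close>, and four further steps followed by one magnification lead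
  from \<open>w\<close> back to \<open>z\<close>.
\<close>

lemma renormalization_cycle:
  defines "z \<equiv> (1 / 4 + sqrt 2 / 4, 1 / 4)"
  shows "z \<in> triangle" "\<exists>j. (ret ^^ j) z = (shrink ^^ 4) z"
proof -
  show z: "z \<in> triangle" using sqrt2_bounds by (simp add: z_def triangle_def)
  define w :: "real \<times> real" where "w = (3 / 4 - sqrt 2 / 2, 1 / 4 + sqrt 2 / 4)"
  have w: "w \<in> triangle" using sqrt2_bounds by (simp add: w_def triangle_def expand)
  have 1: "ret z = (1 / 4, 3 / 4 - sqrt 2 / 2)"
    unfolding z_def using sqrt2_bounds by (subst ret_high) (simp_all add: expand)
  have "shrink w = (3 / 4 - sqrt 2 / 2, 1 / 4)"
    "shrink (3 / 4 - sqrt 2 / 2, 1 / 4) = (1 / 4, sqrt 2 / 4 - 1 / 4)"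
    "shrink (1 / 4, sqrt 2 / 4 - 1 / 4) = (1 / 4, 3 / 4 - sqrt 2 / 2)"
    by (simp_all add: shrink_def w_def expand)
  then have up: "(shrink ^^ 3) w = ret z"
    by (simp add: eval_nat_numeral 1)
  have "ret w = (1 / 4 + sqrt 2 / 4, sqrt 2 / 4 - 1 / 4)"
    unfolding w_def using sqrt2_bounds by (subst ret_high) (simp_all add: expand)
  moreover have "ret (1 / 4 + sqrt 2 / 4, sqrt 2 / 4 - 1 / 4) = (sqrt 2 / 4 - 1 / 4, 1 / 4)"
    using sqrt2_bounds by (subst ret_high) (simp_all add: expand)
  moreover have "(sqrt 2 / 4 - 1 / 4, 1 / 4) \<in> triangle" "sqrt 2 * (sqrt 2 / 4 - 1 / 4) + 1 / 4 < sqrt 2 - 1"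
    using sqrt2_bounds by (simp_all add: triangle_def expand)
  moreover have "shrink z = (sqrt 2 - 1 - sqrt 2 * (sqrt 2 / 4 - 1 / 4) - 1 / 4, sqrt 2 / 4 - 1 / 4)"
    by (simp add: shrink_def z_def expand)
  ultimately have down: "(ret ^^ 4) w = shrink z"
    using ret_ret_low[of "sqrt 2 / 4 - 1 / 4" "1 / 4"] by (simp add: eval_nat_numeral)
  obtain k where "(ret ^^ k) ((shrink ^^ 3) w) = (shrink ^^ 3) ((ret ^^ 4) w)"
    using shrink_funpow_reaches[OF w] by blast
  then have "(ret ^^ k) (ret z) = (shrink ^^ 3) (shrink z)"
    by (simp only: up down)
  then have "(ret ^^ Suc k) z = (shrink ^^ Suc 3) z"
    by (simp only: funpow_Suc_right comp_apply)
  moreover have "Suc 3 = (4 :: nat)" by simp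
  ultimately have "(ret ^^ Suc k) z = (shrink ^^ 4) z" by (simp only:)
  then show "\<exists>j. (ret ^^ j) z = (shrink ^^ 4) z" by blast
qed

lemma rot_rot_start:
  "(T ^^ 2) ((3 - sqrt 2) / 4, (2 * sqrt 2 - 1) / 4) = chart (1 / 4 + sqrt 2 / 4, 1 / 4)"
proof -
  have "T ((3 - sqrt 2) / 4, (2 * sqrt 2 - 1) / 4) = ((2 * sqrt 2 - 1) / 4, 1 / 4)"
    using sqrt2_bounds by (subst rot_0) (simp_all add: expand add_divide_distrib diff_divide_distrib)
  moreover have "T ((2 * sqrt 2 - 1) / 4, 1 / 4) = chart (1 / 4 + sqrt 2 / 4, 1 / 4)"
    using sqrt2_bounds unfolding chart_def
    by (subst rot_neg) (simp_all add: expand add_divide_distrib diff_divide_distrib)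
  ultimately show ?thesis by (simp add: eval_nat_numeral)
qed

theorem theorem5p2:
  shows "(\<forall>z \<in> (Z_sqrt2 \<inter> {0..<1}) \<times> (Z_sqrt2 \<inter> {0..<1}).
            min_period (rot_map (sqrt 2)) z < \<infinity>) \<and>
         aperiodic (\<lambda>k. int_iter unit_square (rot_map (sqrt 2)) k
                          ((3 - sqrt 2) / 4, (2 * sqrt 2 - 1) / 4))"
proof (intro conjI ballI)
  fix z :: "real \<times> real" assume "z \<in> (Z_sqrt2 \<inter> {0..<1}) \<times> (Z_sqrt2 \<inter> {0..<1})"
  then have z: "z \<in> unit_square" "z \<in> Z_sqrt2 \<times> Z_sqrt2"
    by (auto simp: unit_square_def)
  have "\<exists>p\<ge>1. (T ^^ p) z = z"
    by (rule periodic_if_eventually_periodic[OF bij_betw_rot_map z(1) rot_periodic_lattice[OF z]])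
  then show "min_period T z < \<infinity>"
    by (simp add: min_period_def)
next
  let ?z = "((3 - sqrt 2) / 4, (2 * sqrt 2 - 1) / 4) :: real \<times> real"
  let ?w = "(1 / 4 + sqrt 2 / 4, 1 / 4) :: real \<times> real"
  have "(T ^^ p) ?z \<noteq> ?z" if "p \<ge> 1" for p
  proof
    assume per: "(T ^^ p) ?z = ?z"
    have "(T ^^ (p + 2)) ?z = (T ^^ (2 + p)) ?z" by (simp only: add.commute)
    then have "(T ^^ p) (chart ?w) = chart ?w"
      by (simp only: funpow_add comp_apply per rot_rot_start)
    moreover obtain j where "(ret ^^ j) ?w = (shrink ^^ 4) ?w"
      using renormalization_cycle(2) by blast
    ultimately show False
      using self_similar_not_periodic[OF renormalization_cycle(1), of j 4 p] that by simp
  qed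
  then have "min_period T ?z = \<infinity>" unfolding min_period_def by (meson if_not_P)
  moreover have "?z \<in> unit_square" using sqrt2_bounds by (simp add: unit_square_def)
  ultimately show "aperiodic (\<lambda>k. int_iter unit_square T k ?z)"
    using min_period_eq_infinity_iff[OF bij_betw_rot_map] by blast
qed

end
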